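(* Let $n\ge1$ and $m\ge1$ be integers and $t>0$. Let $X_{2n+1}$ be the pseudo-process associated with the equation $\frac{\partial u}{\partial t}=(-1)^n\frac{\partial^{2n+1}u}{\partial x^{2n+1}}$, and let $T^j_{\frac{1}{2n+1}}$, $j=1,2,\ldots,m$, be independent positively skewed stable random variables (subordinators) of order $\frac{1}{2n+1}$. Then the $m$-times iterated pseudo-process $$Z_m(t)=X_{2n+1}\left(T^1_{\frac{1}{2n+1}}\left(T^2_{\frac{1}{2n+1}}\left(\ldots\left(T^m_{\frac{1}{2n+1}}(t)\right)\ldots\right)\right)\right),\qquad t>0,$$ is a stable random variable of order $\frac{1}{(2n+1)^{m-1}}$ with characteristic function $$E e^{i\beta Z_m(t)}=\exp\left[-t|\beta|^{\frac{1}{(2n+1)^{m-1}}}\left(\cos\frac{\pi}{2(2n+1)^m}+i\,\frac{\beta}{|\beta|}\sin\frac{\pi}{2(2n+1)^m}\right)\right],\qquad \beta\in\mathbb{R}\setminus\{0\}.$$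
   Context: The pseudo-process $X_{2n+1}$ has as its (sign-varying) one-dimensional "density" at time $s>0$ the fundamental solution $u_{2n+1}(x,s)$ of $\frac{\partial u}{\partial s}=(-1)^n\frac{\partial^{2n+1}u}{\partial x^{2n+1}}$, $u(x,0)=\delta(x)$, i.e. the function with Fourier transform $\int_{\mathbb{R}}e^{i\beta x}u_{2n+1}(x,s)\,dx=e^{-is\beta^{2n+1}}$. The positively skewed stable random variable $T_\alpha(r)$, $r>0$, $\alpha\in(0,1)$, is the positive random variable with Laplace transform $E e^{-\lambda T_\alpha(r)}=e^{-r\lambda^\alpha}$, $\lambda\ge0$; denote its density at $s>0$ by $h_\alpha(s,r)$. The pseudo-process $X_{2n+1}$ is independent of the $T^j$, and the law of the composition is by definition the one with density $$\frac{\Pr\{Z_m(t)\in dx\}}{dx}=\int_0^\infty\!\!\cdots\int_0^\infty u_{2n+1}(x,s_1)\,h_\alpha(s_1,s_2)\cdots h_\alpha(s_m,s_{m+1})\,ds_1\cdots ds_m,\qquad s_{m+1}=t,\ \alpha=\tfrac{1}{2n+1}.$$ The characteristic function is the Fourier transform $\int_{\mathbb{R}}e^{i\beta x}\Pr\{Z_m(t)\in dx\}$. *)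

theory Defs
  imports "HOL-Probability.Probability"
begin

text \<open>
  The fundamental solution of
  \<open>\<partial>u/\<partial>s = (-1)^n \<partial>^(2n+1)u/\<partial>x^(2n+1)\<close>, \<open>u(x,0) = \<delta>(x)\<close>, is the function whose Fourier
  transform is \<open>exp (-i s \<beta>^(2n+1))\<close>.  For each \<open>s > 0\<close> it is a (generalised Airy) function that is
  bounded and continuous in \<open>x\<close> but not absolutely integrable, so its Fourier integral converges
  only as an improper integral; the Henstock-Kurzweil \<open>has_integral\<close> over the whole line expresses
  exactly this, with the two endpoints tending to infinity independently.  Continuity fixes the
  representative among functions that agree almost everywhere.
\<close>

definition fundamental_solution :: "nat \<Rightarrow> (real \<Rightarrow> real \<Rightarrow> real) \<Rightarrow> bool" where
  "fundamental_solution n u \<longleftrightarrow>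
     (\<forall>s>0. continuous_on UNIV (\<lambda>x. u x s) \<and> bounded (range (\<lambda>x. u x s)) \<and>
        (\<forall>\<beta>::real. ((\<lambda>x. iexp (\<beta> * x) * complex_of_real (u x s)) has_integral
                       exp (- \<i> * complex_of_real (s * \<beta> ^ (2 * n + 1)))) UNIV))"

text \<open>
  \<open>h s r\<close> is the density at \<open>s > 0\<close> of a positive random variable with Laplace transform
  \<open>exp (-r l^\<alpha>)\<close>; the case \<open>l = 0\<close> says that the total mass is 1.
\<close>

definition stable_subordinator_density :: "real \<Rightarrow> (real \<Rightarrow> real \<Rightarrow> real) \<Rightarrow> bool" where
  "stable_subordinator_density \<alpha> h \<longleftrightarrow>
     (\<forall>r>0. (\<forall>s>0. 0 \<le> h s r) \<and>
        (\<forall>l\<ge>0. set_integrable lborel {0<..} (\<lambda>s. exp (- l * s) * h s r) \<and>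
               (LBINT s:{0<..}. exp (- l * s) * h s r) = exp (- r * l powr \<alpha>)))"

text \<open>
  \<open>iterated_density u h m x t\<close> is the iterated integral of
  \<open>u(x,s\<^sub>1) h(s\<^sub>1,s\<^sub>2) \<dots> h(s\<^sub>m,t)\<close> over \<open>s\<^sub>1, \<dots>, s\<^sub>m > 0\<close>, with \<open>s\<^sub>1\<close> innermost.
\<close>

primrec iterated_density ::
  "(real \<Rightarrow> real \<Rightarrow> real) \<Rightarrow> (real \<Rightarrow> real \<Rightarrow> real) \<Rightarrow> nat \<Rightarrow> real \<Rightarrow> real \<Rightarrow> real" where
  "iterated_density u h 0 x r = u x r"
| "iterated_density u h (Suc k) x r =
     (LBINT s:{0<..}. iterated_density u h k x s * h s r)"

text \<open>
  A non-degenerate law is stable of order \<open>\<nu>\<close> if, for independent copies \<open>X\<^sub>1\<close>, \<open>X\<^sub>2\<close> of \<open>X\<close> and all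
  \<open>a, b > 0\<close>, the law of \<open>a X\<^sub>1 + b X\<^sub>2\<close> is that of \<open>c X + d\<close> for some real \<open>d\<close>, where \<open>c > 0\<close> and
  \<open>c^\<nu> = a^\<nu> + b^\<nu>\<close>.
\<close>

definition stable_law :: "real \<Rightarrow> real measure \<Rightarrow> bool" where
  "stable_law \<nu> M \<longleftrightarrow>
     real_distribution M \<and> (\<forall>c. M \<noteq> return borel c) \<and> 0 < \<nu> \<and> \<nu> \<le> 2 \<and>
     (\<forall>a>0. \<forall>b>0. \<exists>d.
        distr (M \<Otimes>\<^sub>M M) borel (\<lambda>(x, y). a * x + b * y) =
        distr M borel (\<lambda>x. (a powr \<nu> + b powr \<nu>) powr (1 / \<nu>) * x + d))"

end

theory Submission
  imports Defs "HOL-Complex_Analysis.Complex_Analysis" "HOL-Real_Asymp.Real_Asymp"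
begin

text \<open>
  Formally, the characteristic function of the composition is obtained by inserting
  \<open>z = i \<beta>^(2n+1)\<close> into the Laplace transform \<open>exp (-r z^\<alpha>)\<close> of the subordinator, extended
  analytically to the closed right half plane, and iterating; each step multiplies both the modulus
  exponent and the angle by \<open>\<alpha>\<close>.  The first step needs care because \<open>u(\<cdot>,s)\<close> has only an improper
  Fourier transform.  Riemann's uniqueness method for trigonometric integrals recovers \<open>u\<close> from that
  transform; this gives the scaling \<open>u(x,s) = s^(-\<alpha>) u(x s^(-\<alpha>), 1)\<close>, and since the negative moment
  \<open>E T^(-\<alpha>)\<close> is finite, dominated convergence and Fubini apply.  One subordination yields a Cauchy
  density.  It is nonnegative, nonnegativity survives further subordination, and a nonnegative inverse
  Fourier transform of an integrable continuous function is automatically integrable.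
\<close>

section \<open>The two-sided exponential kernel\<close>

text \<open>The weight \<open>1 / (1 + x\<^sup>2)\<close> that makes \<open>u\<close> integrable is
  the Fourier transform of \<open>exp (- \<bar>x\<bar>) / 2\<close>, the Green's kernel of 1 -
  (d/db)^2. Weighting in \<open>x\<close> thus corresponds to a convolution in the frequency
  \<open>b\<close>, which makes sense for a symbol that is merely bounded. For integrable
  \<open>u\<close> that correspondence would be a Fubini exchange; here it has to come from
  uniqueness for D'' = D.

  The outcome is a family of Gaussian integrals, built from the symbol alone, that converges to
  \<open>2 * pi * u x / (1 + x\<^sup>2)\<close>. It has two uses. Two candidates with the same
  symbol must coincide. And since \<open>fundamental_solution\<close> constrains each
  \<open>s\<close> separately, it supplies what links different \<open>s\<close>: the symbol is
  explicit in \<open>s\<close>, so the integrals are measurable in \<open>s\<close> and can be mixed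
  over \<open>s\<close> by Fubini, with a limit afterwards.

  After one subordination the symbol decays exponentially in \<open>\<bar>b\<bar>\<close> and
  ordinary Fubini takes over. The sign of the density, hidden in the transform, is read off the
  explicit Cauchy form.\<close>

lemma has_bochner_integral_exp_half_line:
  fixes z :: complex
  assumes "Re z > 0"
  shows "has_bochner_integral lborel (\<lambda>x. indicator {0..} x *\<^sub>R exp (- z * of_real x)) (1 / z)"
proof -
  define c where "c = Re z"
  have c: "c > 0" using assms by (simp add: c_def)
  have "integrable lborel (\<lambda>x::real. x ^ 0 * exp (- x) * indicator {0<..} x)"
    by (rule integrable.intros[OF has_bochner_integral_I0i_power_exp_m[of 0]])
  hence "integrable lborel (\<lambda>x::real. exp (- (0 + c * x)) * indicator {0<..} (0 + c * x))"
    using lborel_integrable_real_affine[of "\<lambda>x. exp (- x) * indicator {0<..} x" c 0] c by simp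
  also have "(\<lambda>x::real. exp (- (0 + c * x)) * indicator {0<..} (0 + c * x)) =
      (\<lambda>x. exp (- c * x) * indicator {0<..} x)"
    using c by (auto simp: indicator_def zero_less_mult_iff)
  finally have i0: "integrable lborel (\<lambda>x::real. exp (- c * x) * indicator {0<..} x)" .
  have i: "integrable lborel (\<lambda>x. indicator {0..} x *\<^sub>R exp (- z * of_real x))"
    by (rule Bochner_Integration.integrable_bound[OF i0])
       (auto simp: c_def indicator_def intro!: AE_I[where N="{0::real}"])
  have i': "set_integrable lborel (einterval 0 \<infinity>) (\<lambda>x. exp (- z * of_real x))"
    unfolding set_integrable_def
    by (rule Bochner_Integration.integrable_bound[OF i])
       (auto simp: indicator_def einterval_def zero_ereal_def)
  have z: "z \<noteq> 0" using assms by auto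
  have lim: "((\<lambda>x. - exp (- z * of_real x) / z) \<longlongrightarrow> 0) at_top"
  proof (rule Lim_null_comparison)
    show "\<forall>\<^sub>F x in at_top. norm (- exp (- z * of_real x) / z) \<le> exp (- c * x) / norm z"
      by (intro always_eventually) (auto simp: norm_divide c_def)
    show "((\<lambda>x. exp (- c * x) / norm z) \<longlongrightarrow> 0) at_top"
      using c z by real_asymp
  qed
  have "(LBINT x=0..\<infinity>. exp (- z * of_real x)) = 0 - (- 1 / z)"
  proof (rule interval_integral_FTC_integrable[where F = "\<lambda>x. - exp (- z * of_real x) / z"])
    fix x :: real
    have "((\<lambda>y. - exp (- z * y) / z) has_field_derivative exp (- z * of_real x)) (at (of_real x))"
      using z by (auto intro!: derivative_eq_intros simp: field_simps)
    from has_vector_derivative_real_field[OF this]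
    show "((\<lambda>x. - exp (- z * of_real x) / z) has_vector_derivative exp (- z * of_real x)) (at x)" .
    show "isCont (\<lambda>x. exp (- z * of_real x)) x" by (intro continuous_intros)
  next
    show "(((\<lambda>x. - exp (- z * of_real x) / z) \<circ> real_of_ereal) \<longlongrightarrow> - 1 / z) (at_right 0)"
      unfolding zero_ereal_def ereal_tendsto_simps
      by (rule tendsto_eq_intros refl | use z in simp)+
    show "(((\<lambda>x. - exp (- z * of_real x) / z) \<circ> real_of_ereal) \<longlongrightarrow> 0) (at_left \<infinity>)"
      unfolding ereal_tendsto_simps by (rule lim)
  qed (use i' in auto)
  also have "(LBINT x=0..\<infinity>. exp (- z * of_real x)) = (LBINT x. indicator {0..} x *\<^sub>R exp (- z * of_real x))"
    unfolding interval_lebesgue_integral_def set_lebesgue_integral_def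
    by (auto simp: einterval_def zero_ereal_def indicator_def of_bool_def intro!: integral_cong_AE
        AE_I[where N="{0::real}"] split: if_splits)
  finally show ?thesis using i by (simp add: has_bochner_integral_iff)
qed

text \<open>With \<open>z = w = 1\<close> this normalises the Laplace density; with
  \<open>w = cnj z\<close> it is the inversion integral that produces the Cauchy density.\<close>

lemma has_bochner_integral_exp_two_sided:
  fixes z w :: complex
  assumes "Re z > 0" "Re w > 0"
  shows "has_bochner_integral lborel
    (\<lambda>x. if x \<ge> 0 then exp (- z * of_real x) else exp (w * of_real x)) (1 / z + 1 / w)"
proof -
  have "has_bochner_integral lborel (\<lambda>x. indicator {0..} (- x) *\<^sub>R exp (- w * of_real (- x))) (1 / w)"
    using has_bochner_integral_exp_half_line[OF assms(2)]
      lborel_has_bochner_integral_real_affine_iff[of "-1"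
        "\<lambda>x. indicator {0..} x *\<^sub>R exp (- w * of_real x)" "1 / w" 0] by simp
  from has_bochner_integral_add[OF has_bochner_integral_exp_half_line[OF assms(1)] this]
  have *: "has_bochner_integral lborel (\<lambda>x. indicator {0..} x *\<^sub>R exp (- z * of_real x) +
      indicator {0..} (- x) *\<^sub>R exp (- w * of_real (- x))) (1 / z + 1 / w)" .
  show ?thesis
    by (rule has_bochner_integralI_AE[OF *])
       (auto simp: indicator_def intro!: AE_I[where N="{0::real}"])
qed

text \<open>The Green's kernel of 1 - (d/dx)^2, with Fourier transform
  \<open>1 / (1 + x\<^sup>2)\<close>.\<close>

definition laplace_density :: "real \<Rightarrow> real" where
  "laplace_density x = exp (- \<bar>x\<bar>) / 2"

lemma laplace_density_nonneg [simp]: "laplace_density x \<ge> 0"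
  by (simp add: laplace_density_def)

lemma laplace_density_minus [simp]: "laplace_density (- x) = laplace_density x"
  by (simp add: laplace_density_def)

lemma laplace_density_measurable [measurable]: "laplace_density \<in> borel_measurable borel"
  unfolding laplace_density_def[abs_def] by measurable

lemma has_bochner_integral_laplace_density: "has_bochner_integral lborel laplace_density 1"
proof -
  have "has_bochner_integral lborel
    (\<lambda>x. Re ((if x \<ge> 0 then exp (- 1 * of_real x) else exp (1 * of_real x)) / 2)) (Re ((1 / 1 + 1 / 1) / 2))"
    by (intro has_bochner_integral_bounded_linear[OF bounded_linear_Re]
        has_bochner_integral_divide_zero has_bochner_integral_exp_two_sided) auto
  also have "(\<lambda>x. Re ((if x \<ge> 0 then exp (- 1 * of_real x) else exp (1 * of_real x)) / 2)) = laplace_density"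
    by (auto simp: laplace_density_def fun_eq_iff Re_exp)
  finally show ?thesis by simp
qed

lemma integrable_laplace_density_translate [simp]:
  "integrable lborel (\<lambda>x. laplace_density (y - x))"
  using lborel_integrable_real_affine[of laplace_density "-1" y] has_bochner_integral_laplace_density
  by (simp add: has_bochner_integral_iff)

lemma integral_laplace_density_translate [simp]: "(LBINT x. laplace_density (y - x)) = 1"
  using lborel_integral_real_affine[of "-1" laplace_density y] has_bochner_integral_laplace_density
  by (simp add: has_bochner_integral_iff)

text \<open>A discrete form of L'' = L - delta. Away from the kink the kernel is a pure exponential,
  for which the two shifts sum to the factor \<open>2 * cosh h\<close>. A correction appears only
  when \<open>z - h\<close> and \<open>z + h\<close> straddle 0: the sinh bump, which stands for h^2
  times delta.\<close>

lemma laplace_density_second_difference: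
  assumes "h > 0"
  shows "laplace_density (z + h) + laplace_density (z - h) =
    2 * cosh h * laplace_density z - (if \<bar>z\<bar> < h then sinh (h - \<bar>z\<bar>) else 0)"
proof -
  have *: "laplace_density (z + h) + laplace_density (z - h) =
    2 * cosh h * laplace_density z - (if \<bar>z\<bar> < h then sinh (h - \<bar>z\<bar>) else 0)" if "z \<ge> 0" for z
    using that assms
    by (auto simp: laplace_density_def cosh_def sinh_def abs_if field_simps exp_add[symmetric]
        simp flip: exp_minus)
  show ?thesis
  proof (cases "z \<ge> 0")
    case True
    thus ?thesis by (rule *)
  next
    case False
    have "laplace_density (z + h) = laplace_density (- z - h)"
      "laplace_density (z - h) = laplace_density (- z + h)"
      by (simp_all add: laplace_density_def abs_if)
    thus ?thesis using *[of "- z"] False by simp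
  qed
qed

definition laplace_smooth :: "(real \<Rightarrow> complex) \<Rightarrow> real \<Rightarrow> complex" where
  "laplace_smooth V b = (LBINT g. of_real (laplace_density (b - g)) * V g)"

lemma integrable_laplace_smooth:
  fixes V :: "real \<Rightarrow> complex"
  assumes [measurable]: "V \<in> borel_measurable borel" and "\<And>g. norm (V g) \<le> C"
  shows "integrable lborel (\<lambda>g. of_real (laplace_density (b - g)) * V g)"
proof (rule Bochner_Integration.integrable_bound)
  show "integrable lborel (\<lambda>g. C * laplace_density (b - g))" by simp
  show "AE g in lborel. norm (of_real (laplace_density (b - g)) * V g) \<le> norm (C * laplace_density (b - g))"
  proof (intro AE_I2)
    fix g
    have "laplace_density (b - g) * norm (V g) \<le> laplace_density (b - g) * \<bar>C\<bar>"
      by (intro mult_left_mono order_trans[OF assms(2) abs_ge_self]) simp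
    thus "norm (of_real (laplace_density (b - g)) * V g) \<le> norm (C * laplace_density (b - g))"
      by (simp add: norm_mult abs_mult mult.commute)
  qed
qed simp

lemma norm_laplace_smooth_le:
  fixes V :: "real \<Rightarrow> complex"
  assumes [measurable]: "V \<in> borel_measurable borel" and "\<And>g. norm (V g) \<le> C"
  shows "norm (laplace_smooth V b) \<le> C"
proof -
  have "norm (laplace_smooth V b) \<le> (LBINT g. laplace_density (b - g) * C)"
    unfolding laplace_smooth_def
    by (rule Bochner_Integration.integral_norm_bound_integral)
       (auto intro!: integrable_laplace_smooth[OF assms] mult_left_mono assms simp: norm_mult)
  thus ?thesis by simp
qed

text \<open>The second difference passes to the kernel and leaves an exact remainder,
  \<open>V\<close> integrated against the sinh bump. The bump is nonnegative, lives within
  \<open>h\<close> of \<open>b\<close> and has mass \<open>2 * cosh h - 2\<close>, so replacing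
  \<open>V g\<close> by \<open>V b\<close> costs at most that mass times the oscillation of
  \<open>V\<close> near \<open>b\<close>.\<close>

lemma laplace_smooth_second_difference:
  assumes V [measurable]: "V \<in> borel_measurable borel" and C: "\<And>g. norm (V g) \<le> C" and "h > 0"
    and d: "\<And>g. \<bar>g - b\<bar> < h \<Longrightarrow> norm (V g - V b) \<le> d"
  shows "norm (laplace_smooth V (b + h) + laplace_smooth V (b - h) - 2 * laplace_smooth V b
      - of_real (2 * cosh h - 2) * (laplace_smooth V b - V b)) \<le> (2 * cosh h - 2) * d"
proof -
  define k where "k g = (if \<bar>b - g\<bar> < h then sinh (h - \<bar>b - g\<bar>) else 0)" for g
  have k_eq: "k g = 2 * cosh h * laplace_density (b - g)
      - laplace_density (b + h - g) - laplace_density (b - h - g)" for g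
    using laplace_density_second_difference[OF \<open>h > 0\<close>, of "b - g"]
    by (simp add: k_def algebra_simps)
  have k0: "k g \<ge> 0" for g by (auto simp: k_def)
  have [measurable]: "k \<in> borel_measurable borel"
    unfolding k_eq[abs_def] by measurable
  have ki: "integrable lborel k" 
    unfolding k_eq[abs_def] by simp
  have kI: "(LBINT g. k g) = 2 * cosh h - 2"
    unfolding k_eq[abs_def] by simp
  note i = integrable_laplace_smooth[OF V C]
  have kV: "(\<lambda>g. of_real (k g) * V g) = (\<lambda>g. of_real (2 * cosh h) * (of_real (laplace_density (b - g)) * V g)
    - of_real (laplace_density (b + h - g)) * V g - of_real (laplace_density (b - h - g)) * V g)"
    by (auto simp: k_eq algebra_simps fun_eq_iff)
  have kVi: "integrable lborel (\<lambda>g. of_real (k g) * V g)"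
    unfolding kV by (intro Bochner_Integration.integrable_diff integrable_mult_right i)
  have "(LBINT g. of_real (k g) * V g) = of_real (2 * cosh h) * laplace_smooth V b
     - laplace_smooth V (b + h) - laplace_smooth V (b - h)"
    unfolding kV laplace_smooth_def by (simp add: i)
  moreover have "(LBINT g. of_real (k g) * V b) = of_real (2 * cosh h - 2) * V b"
    using kI by simp
  ultimately have "laplace_smooth V (b + h) + laplace_smooth V (b - h) - 2 * laplace_smooth V b
      - of_real (2 * cosh h - 2) * (laplace_smooth V b - V b) 
     = (LBINT g. of_real (k g) * V b) - (LBINT g. of_real (k g) * V g)"
    by (simp add: algebra_simps kI)
  also have "\<dots> = (LBINT g. of_real (k g) * V b - of_real (k g) * V g)"
    by (rule Bochner_Integration.integral_diff[symmetric]) (use ki kVi in auto)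
  also have "norm \<dots> \<le> (LBINT g. k g * d)"
  proof (rule Bochner_Integration.integral_norm_bound_integral)
    fix g
    have "norm (of_real (k g) * V b - of_real (k g) * V g) = k g * norm (V g - V b)"
      using k0[of g] by (simp add: norm_minus_commute norm_mult flip: right_diff_distrib)
    also have "\<dots> \<le> k g * d"
    proof (cases "\<bar>g - b\<bar> < h")
      case True
      thus ?thesis using d k0 by (intro mult_left_mono) auto
    qed (simp add: k_def abs_minus_commute)
    finally show "norm (of_real (k g) * V b - of_real (k g) * V g) \<le> k g * d" .
  qed (use ki kVi in auto)
  finally show ?thesis using kI by simp
qed

lemma laplace_smooth_second_derivative:
  assumes V: "continuous_on UNIV V" and C: "\<And>g. norm (V g) \<le> C"
  defines "G \<equiv> laplace_smooth V"
  shows "((\<lambda>h. (G (b + h) + G (b - h) - 2 * G b) / of_real (h\<^sup>2)) \<longlongrightarrow> G b - V b) (at_right 0)"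
proof -
  have Vm: "V \<in> borel_measurable borel" by (rule borel_measurable_continuous_onI[OF V])
  \<comment> \<open>The mass of the sinh bump is the natural divisor; it is exchanged for h^2 at the
    end because their ratio tends to 1.\<close>
  define q :: "real \<Rightarrow> real" where "q h = 2 * cosh h - 2" for h
  have q_pos: "q h > 0" if "h > 0" for h
    using that cosh_real_strict_mono[of 0 h] by (simp add: q_def)
  have q_lim: "((\<lambda>h. q h / h\<^sup>2) \<longlongrightarrow> 1) (at_right 0)"
    unfolding q_def cosh_field_def by real_asymp
  have "((\<lambda>h. (G (b + h) + G (b - h) - 2 * G b) / of_real (q h)) \<longlongrightarrow> G b - V b) (at_right 0)"
  proof (rule tendstoI)
    fix e :: real assume "e > 0"
    have "isCont V b" using V by (simp add: continuous_on_eq_continuous_at)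
    then obtain r where r: "r > 0" "\<And>g. \<bar>g - b\<bar> < r \<Longrightarrow> norm (V g - V b) < e / 2"
      using \<open>e > 0\<close> unfolding continuous_at_eps_delta by (metis dist_norm half_gt_zero real_norm_def)
    have "eventually (\<lambda>h. h \<in> {0<..<r}) (at_right 0)"
      using r(1) by (rule eventually_at_right_real)
    thus "\<forall>\<^sub>F h in at_right 0. dist ((G (b + h) + G (b - h) - 2 * G b) / of_real (q h)) (G b - V b) < e"
    proof eventually_elim
      case (elim h)
      hence h: "h > 0" "h < r" by auto
      have qn: "q h \<noteq> 0" using q_pos[OF h(1)] by simp
      have "norm (G (b + h) + G (b - h) - 2 * G b - q h * (G b - V b)) \<le> q h * (e / 2)"
        unfolding G_def q_def using h r(2) 
        by (intro laplace_smooth_second_difference[OF Vm C h(1)])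
           (auto intro: less_imp_le)
      also have "\<dots> < q h * e" using q_pos[OF h(1)] \<open>e > 0\<close> by simp
      finally have "norm (G (b + h) + G (b - h) - 2 * G b - q h * (G b - V b)) / q h < e"
        using q_pos[OF h(1)] by (simp add: field_simps)
      also have "norm (G (b + h) + G (b - h) - 2 * G b - q h * (G b - V b)) / q h =
          norm ((G (b + h) + G (b - h) - 2 * G b - q h * (G b - V b)) / q h)"
        using q_pos[OF h(1)] by (simp add: norm_divide)
      also have "(G (b + h) + G (b - h) - 2 * G b - q h * (G b - V b)) / q h
         = (G (b + h) + G (b - h) - 2 * G b) / q h - (G b - V b)"
        using qn by (simp add: diff_divide_distrib)
      finally show ?case by (simp add: dist_norm)
    qed
  qed
  from tendsto_mult[OF this tendsto_of_real[OF q_lim]]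
  have "((\<lambda>h. (G (b + h) + G (b - h) - 2 * G b) / of_real (q h) * of_real (q h / h\<^sup>2)) \<longlongrightarrow> (G b - V b) * of_real 1)
     (at_right 0)" .
  moreover have "\<forall>\<^sub>F h in at_right 0. (G (b + h) + G (b - h) - 2 * G b) / of_real (q h) * of_real (q h / h\<^sup>2)
       = (G (b + h) + G (b - h) - 2 * G b) / of_real (h\<^sup>2)"
    unfolding eventually_at_right_field using q_pos 
    by (intro exI[of _ 1]) (auto simp: less_imp_neq[symmetric])
  ultimately show ?thesis
    unfolding of_real_1 mult_1_right by (rule Lim_transform_eventually)
qed

text \<open>Subtracting \<open>e * x\<^sup>2\<close> from a function bounded above forces a global
  maximum. There the second difference of the penalised function is nonpositive, so the quotient of
  \<open>D\<close> is at most \<open>2 * e\<close>; but its limit is the value of \<open>D\<close>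
  at that point. Letting \<open>e\<close> tend to 0 finishes. Convergence along a single null
  sequence of steps is all that the applications provide.\<close>

lemma second_difference_maximum_principle:
  fixes D :: "real \<Rightarrow> real"
  assumes cont: "continuous_on UNIV D" and bdd: "\<And>b. D b \<le> C"
    and h: "\<And>k. h k > 0"
    and lim: "\<And>b. (\<lambda>k. (D (b + h k) + D (b - h k) - 2 * D b) / (h k)\<^sup>2) \<longlonglongrightarrow> D b"
  shows "D b \<le> 0"
proof -
  have le: "D b \<le> e * (2 + b\<^sup>2)" if "e > 0" for e b
  proof -
    define E where "E x = D x - e * x\<^sup>2" for x
    \<comment> \<open>Outside \<open>{-R..R}\<close> the penalty \<open>e * y\<^sup>2\<close> is at
      least \<open>C - E b\<close>, hence \<open>E y \<le> E b\<close>; the summand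
      \<open>\<bar>b\<bar>\<close> keeps \<open>b\<close> inside, so the maximum over the interval
      is global.\<close>
    define R where "R = \<bar>b\<bar> + sqrt (\<bar>C - E b\<bar> / e)"
    have "R \<ge> 0" using that by (simp add: R_def)
    have "continuous_on {-R..R} E"
      unfolding E_def by (intro continuous_intros continuous_on_subset[OF cont]) auto
    then obtain x where x: "x \<in> {-R..R}" "\<And>y. y \<in> {-R..R} \<Longrightarrow> E y \<le> E x"
      using continuous_attains_sup[of "{-R..R}" E] \<open>R \<ge> 0\<close> by auto
    have "sqrt (\<bar>C - E b\<bar> / e) \<ge> 0" using that by simp
    hence b: "b \<in> {-R..R}" unfolding R_def atLeastAtMost_iff by linarith
    have out: "E y \<le> E b" if "y \<notin> {-R..R}" for y
    proof -
      have "sqrt (\<bar>C - E b\<bar> / e) \<le> \<bar>y\<bar>" using that by (auto simp: R_def)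
      hence "\<bar>C - E b\<bar> / e \<le> y\<^sup>2" 
        using \<open>e > 0\<close> real_le_rsqrt sqrt_le_D by fastforce
      hence "C - E b \<le> e * y\<^sup>2" using \<open>e > 0\<close> by (simp add: field_simps abs_if split: if_splits)
      thus ?thesis using bdd[of y] by (simp add: E_def)
    qed
    have max: "E y \<le> E x" for y
      using x(2)[OF b] x(2)[of y] out[of y] by fastforce
    have "D x \<le> 2 * e"
    proof (rule LIMSEQ_le_const2[OF lim], intro exI allI impI)
      fix k
      have "D (x + h k) + D (x - h k) - 2 * D x = 
          (E (x + h k) - E x) + (E (x - h k) - E x) + 2 * e * (h k)\<^sup>2"
        by (simp add: E_def power2_eq_square algebra_simps)
      also have "\<dots> \<le> 2 * e * (h k)\<^sup>2" using max[of "x + h k"] max[of "x - h k"] by simp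
      finally show "(D (x + h k) + D (x - h k) - 2 * D x) / (h k)\<^sup>2 \<le> 2 * e"
        using h[of k] by (simp add: field_simps)
    qed
    moreover have "e * x\<^sup>2 \<ge> 0" using that by simp
    ultimately show ?thesis using max[of b] by (simp add: E_def algebra_simps)
  qed
  show ?thesis
  proof (rule field_le_epsilon)
    fix e :: real assume "e > 0"
    have "2 + b\<^sup>2 > 0" by (simp add: add_pos_nonneg)
    thus "D b \<le> 0 + e" using le[of "e / (2 + b\<^sup>2)" b] \<open>e > 0\<close> by simp
  qed
qed

text \<open>The real principle for \<open>Re (c * D b)\<close> with \<open>c\<close> = 1, -1, i, -i
  bounds the real and imaginary parts from both sides.\<close>

lemma second_difference_eq_zero:
  fixes D :: "real \<Rightarrow> complex"
  assumes cont: "continuous_on UNIV D" and bdd: "\<And>b. norm (D b) \<le> C"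
    and h: "\<And>k. h k > 0"
    and lim: "\<And>b. (\<lambda>k. (D (b + h k) + D (b - h k) - 2 * D b) / of_real ((h k)\<^sup>2)) \<longlonglongrightarrow> D b"
  shows "D b = 0"
proof -
  have "Re (c * D b) \<le> 0" if "norm c = 1" for c
  proof (rule second_difference_maximum_principle[where h = h and D = "\<lambda>b. Re (c * D b)" and C = C])
    show "continuous_on UNIV (\<lambda>b. Re (c * D b))" by (intro continuous_intros cont)
    show "Re (c * D b) \<le> C" for b
      using complex_Re_le_cmod[of "c * D b"] bdd[of b] that by (simp add: norm_mult)
    fix b
    have "(\<lambda>k. Re (c * ((D (b + h k) + D (b - h k) - 2 * D b) / of_real ((h k)\<^sup>2)))) \<longlonglongrightarrow> Re (c * D b)"
      by (intro tendsto_intros lim)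
    moreover have "Re (c * ((D (b + h k) + D (b - h k) - 2 * D b) / of_real ((h k)\<^sup>2))) =
       (Re (c * D (b + h k)) + Re (c * D (b - h k)) - 2 * Re (c * D b)) / (h k)\<^sup>2" for k
      unfolding times_divide_eq_right Re_divide_of_real by (simp add: algebra_simps)
    ultimately show "(\<lambda>k. (Re (c * D (b + h k)) + Re (c * D (b - h k)) - 2 * Re (c * D b)) / (h k)\<^sup>2)
        \<longlonglongrightarrow> Re (c * D b)" by (simp only:)
  qed (use h in auto)
  from this[of 1] this[of "-1"] this[of \<i>] this[of "-\<i>"] show ?thesis
    by (simp add: complex_eq_iff)
qed

section \<open>Fejer means of improper integrals\<close>

lemma integrable_inverse_1_plus_square_lborel: "integrable lborel (\<lambda>x::real. 1 / (1 + x\<^sup>2))"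
  using integrable_inverse_1_plus_square by (simp add: set_integrable_def divide_inverse)

lemma integrable_inverse_1_plus_square_scaled:
  assumes "h > 0"
  shows "integrable lborel (\<lambda>x::real. c / (1 + (h * x)\<^sup>2))"
  using lborel_integrable_real_affine[OF integrable_mult_right[OF integrable_inverse_1_plus_square_lborel, of c], of h 0] assms
  by simp

text \<open>The square of sin(z/2) / (z/2). It arises as the multiplier of a symmetric second
  difference: e^(iz) + e^(-iz) - 2 equals -z^2 times it.\<close>

definition fejer :: "real \<Rightarrow> real" where
  "fejer z = (if z = 0 then 1 else (2 - 2 * cos z) / z\<^sup>2)"

text \<open>The derivative of \<open>fejer\<close> for z > 0. At 0 division by zero makes it 0; it
  is integrated over \<open>{0<..}\<close> only.\<close>

definition fejer' :: "real \<Rightarrow> real" where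
  "fejer' z = 2 * (z * sin z - 2 + 2 * cos z) / z ^ 3"

lemma fejer_measurable [measurable]: "fejer \<in> borel_measurable borel"
  unfolding fejer_def[abs_def] by measurable

lemma fejer'_measurable [measurable]: "fejer' \<in> borel_measurable borel"
  unfolding fejer'_def[abs_def] by measurable

lemma fejer_minus [simp]: "fejer (- z) = fejer z"
  by (simp add: fejer_def)

lemma fejer_bounds: "0 \<le> fejer z" "fejer z \<le> 1" "fejer z \<le> 8 / (1 + z\<^sup>2)"
proof -
  have c: "2 - 2 * cos z \<le> z\<^sup>2"
  proof -
    have "(sin (z / 2))\<^sup>2 \<le> (z / 2)\<^sup>2"
      using abs_sin_x_le_abs_x[of "z / 2"] by (simp only: abs_le_square_iff)
    thus ?thesis using cos_double_sin[of "z / 2"] by (simp add: power_divide)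
  qed
  show "0 \<le> fejer z" by (simp add: fejer_def)
  show 1: "fejer z \<le> 1" using c by (simp add: fejer_def)
  \<comment> \<open>The numerator of \<open>fejer\<close> is at most 4, and 2 z^2 exceeds 1 + z^2
    once z^2 > 1, whence the 8. For z^2 at most 1 the bound by 1 is already stronger.\<close>
  show "fejer z \<le> 8 / (1 + z\<^sup>2)"
  proof (cases "z\<^sup>2 \<le> 1")
    case True
    hence "1 \<le> 8 / (1 + z\<^sup>2)" by (simp add: field_simps add_pos_nonneg)
    with 1 show ?thesis by linarith
  next
    case False
    have "2 - 2 * cos z \<le> 4" using cos_ge_minus_one[of z] by linarith
    hence "fejer z \<le> 4 / z\<^sup>2" using False unfolding fejer_def
      by (auto intro!: divide_right_mono)
    also have "4 / z\<^sup>2 = 8 / (2 * z\<^sup>2)" by simp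
    also have "\<dots> \<le> 8 / (1 + z\<^sup>2)" using False
      by (intro divide_left_mono mult_pos_pos) (auto intro: add_pos_nonneg)
    finally show ?thesis .
  qed
qed

text \<open>Near 0 the numerator cancels to order z^4, which leaves a bound of order z after
  division by z^3. For z > 1 it is at most 5 z, giving 10 / z^2, and z^2 > 1 turns this into the
  constant 20.\<close>

lemma fejer'_bound:
  assumes "z > 0"
  shows "\<bar>fejer' z\<bar> \<le> 20 / (1 + z\<^sup>2)"
proof (cases "z \<le> 1")
  case True
  have "\<bar>Im (iexp z - (\<Sum>k\<le>2. (\<i> * z) ^ k / fact k))\<bar> \<le> \<bar>z\<bar> ^ 3 / fact 3"
    using order_trans[OF abs_Im_le_cmod iexp_approx1[of z 2]] by (simp add: numeral_3_eq_3)
  hence s: "\<bar>sin z - z\<bar> \<le> z ^ 3 / 6" using assms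
    by (simp add: Im_exp numeral_2_eq_2 fact_numeral)
  have "\<bar>Re (iexp z - (\<Sum>k\<le>3. (\<i> * z) ^ k / fact k))\<bar> \<le> \<bar>z\<bar> ^ 4 / fact 4"
    using order_trans[OF abs_Re_le_cmod iexp_approx1[of z 3]] by simp
  hence c: "\<bar>cos z - 1 + z\<^sup>2 / 2\<bar> \<le> z ^ 4 / 24" using assms
    by (simp add: Re_exp numeral_3_eq_3 fact_numeral power2_eq_square algebra_simps)
  \<comment> \<open>The z^2 terms of the two Taylor polynomials cancel, so only the remainders of
    order z^3 and z^4 are left to estimate.\<close>
  have "z * sin z - 2 + 2 * cos z = z * (sin z - z) + 2 * (cos z - 1 + z\<^sup>2 / 2)"
    by (simp add: algebra_simps power2_eq_square)
  also have "\<bar>\<dots>\<bar> \<le> z * (z ^ 3 / 6) + 2 * (z ^ 4 / 24)"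
  proof (intro order_trans[OF abs_triangle_ineq] add_mono)
    show "\<bar>z * (sin z - z)\<bar> \<le> z * (z ^ 3 / 6)"
      using mult_left_mono[OF s, of z] assms by (simp only: abs_mult abs_of_pos)
    show "\<bar>2 * (cos z - 1 + z\<^sup>2 / 2)\<bar> \<le> 2 * (z ^ 4 / 24)"
      using mult_left_mono[OF c zero_le_numeral] by (simp only: abs_mult abs_numeral)
  qed
  also have "\<dots> = z ^ 3 * (z / 4)" by (simp add: field_simps eval_nat_numeral)
  finally have "\<bar>z * sin z - 2 + 2 * cos z\<bar> \<le> z ^ 3 * (z / 4)" .
  hence "2 * \<bar>z * sin z - 2 + 2 * cos z\<bar> / z ^ 3 \<le> 2 * (z ^ 3 * (z / 4)) / z ^ 3"
    using assms by (intro divide_right_mono mult_left_mono) auto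
  also have "2 * \<bar>z * sin z - 2 + 2 * cos z\<bar> / z ^ 3 = \<bar>fejer' z\<bar>"
    unfolding fejer'_def abs_divide abs_mult using assms by simp
  also have "2 * (z ^ 3 * (z / 4)) / z ^ 3 = z / 2" using assms by simp
  also have "\<dots> \<le> 10" using True by simp
  also have "z\<^sup>2 \<le> 1" using True assms by (simp add: power_le_one)
  hence "10 \<le> 20 / (1 + z\<^sup>2)" by (simp add: field_simps add_pos_nonneg)
  finally show ?thesis .
next
  case False
  have "\<bar>z * sin z - 2 + 2 * cos z\<bar> \<le> z * 1 + 4"
  proof -
    have "\<bar>z * sin z\<bar> \<le> z * 1" using assms unfolding abs_mult by (intro mult_mono) auto
    thus ?thesis using cos_ge_minus_one[of z] cos_le_one[of z] by linarith
  qed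
  also have "\<dots> \<le> 5 * z" using False by simp
  finally have "2 * \<bar>z * sin z - 2 + 2 * cos z\<bar> / z ^ 3 \<le> 2 * (5 * z) / z ^ 3"
    using assms by (intro divide_right_mono mult_left_mono) auto
  also have "2 * (5 * z) / z ^ 3 = 10 / z\<^sup>2" using assms by (simp add: field_simps eval_nat_numeral)
  also have "1 \<le> z\<^sup>2" using False by simp
  hence "10 / z\<^sup>2 \<le> 20 / (1 + z\<^sup>2)" using assms by (simp add: field_simps add_pos_nonneg)
  also have "2 * \<bar>z * sin z - 2 + 2 * cos z\<bar> / z ^ 3 = \<bar>fejer' z\<bar>"
    unfolding fejer'_def abs_divide abs_mult using assms by simp
  finally show ?thesis .
qed

lemma fejer_deriv:
  assumes "z > 0"
  shows "(fejer has_real_derivative fejer' z) (at z)"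
proof (rule DERIV_cong_ev[THEN iffD1])
  show "((\<lambda>z. (2 - 2 * cos z) / z\<^sup>2) has_real_derivative fejer' z) (at z)"
    using assms unfolding fejer'_def
    by (auto intro!: derivative_eq_intros simp: field_simps eval_nat_numeral)
  have "\<forall>\<^sub>F x in nhds z. x \<in> {0<..}" using assms by (intro eventually_nhds_in_open) auto
  thus "\<forall>\<^sub>F x in nhds z. (2 - 2 * cos x) / x\<^sup>2 = fejer x"
    by eventually_elim (simp add: fejer_def)
qed auto

lemma fejer_tendsto_1: "(fejer \<longlongrightarrow> 1) (at_right 0)"
proof -
  have "((\<lambda>z::real. (2 - 2 * cos z) / z\<^sup>2) \<longlongrightarrow> 1) (at_right 0)" by real_asymp
  thus ?thesis
    by (rule Lim_transform_eventually)
       (auto simp: eventually_at_right_field fejer_def intro!: exI[of _ 1])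
qed

lemma fejer_tendsto_0: "(fejer \<longlongrightarrow> 0) at_top"
proof (rule tendsto_sandwich[OF _ _ tendsto_const])
  show "((\<lambda>z::real. 8 / (1 + z\<^sup>2)) \<longlongrightarrow> 0) at_top" by real_asymp
qed (auto intro!: always_eventually fejer_bounds)

lemma isCont_fejer': "z > 0 \<Longrightarrow> isCont fejer' z"
  unfolding fejer'_def[abs_def] by (intro continuous_intros) auto

lemma set_integrable_fejer': "set_integrable lborel {0<..} fejer'"
  unfolding set_integrable_def
  by (rule Bochner_Integration.integrable_bound[OF integrable_inverse_1_plus_square_scaled[of 1 20]])
     (use fejer'_bound in \<open>auto simp: indicator_def\<close>)

lemma einterval_0_infinity: "einterval 0 \<infinity> = {0<..}"
  by (auto simp: einterval_def zero_ereal_def)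

text \<open>Hence \<open>- fejer'\<close> is an absolutely integrable averaging kernel of mass 1,
  though not of one sign. This is the regularity of the Fejer summation method.\<close>

lemma integral_fejer': "(LBINT z:{0<..}. fejer' z) = - 1"
proof -
  have "(LBINT z=0..\<infinity>. fejer' z) = 0 - 1"
  proof (rule interval_integral_FTC_integrable[where F = fejer])
    show "((fejer \<circ> real_of_ereal) \<longlongrightarrow> 1) (at_right 0)"
      unfolding zero_ereal_def ereal_tendsto_simps by (rule fejer_tendsto_1)
    show "((fejer \<circ> real_of_ereal) \<longlongrightarrow> 0) (at_left \<infinity>)"
      unfolding ereal_tendsto_simps by (rule fejer_tendsto_0)
    show "set_integrable lborel (einterval 0 \<infinity>) fejer'"
      using set_integrable_fejer' by (simp add: einterval_0_infinity)
  qed (auto simp: zero_ereal_def isCont_fejer' fejer_deriv simp flip: has_real_derivative_iff_has_vector_derivative)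
  thus ?thesis by (simp add: interval_lebesgue_integral_def einterval_0_infinity)
qed

lemma bounded_if_convergent_at_top:
  fixes S :: "real \<Rightarrow> 'a :: real_normed_vector"
  assumes "continuous_on {0..} S" and "(S \<longlongrightarrow> L) at_top"
  obtains M where "M > 0" "\<And>x. x \<ge> 0 \<Longrightarrow> norm (S x) \<le> M"
proof -
  have "\<forall>\<^sub>F x in at_top. dist (S x) L < 1" using assms(2) by (rule tendstoD) simp
  then obtain N where N: "\<And>x. x \<ge> N \<Longrightarrow> dist (S x) L < 1" by (auto simp: eventually_at_top_linorder)
  have "compact (S ` {0..N})"
    by (intro compact_continuous_image continuous_on_subset[OF assms(1)]) auto
  then obtain B where B: "B > 0" "\<And>x. x \<in> {0..N} \<Longrightarrow> norm (S x) \<le> B"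
    using compact_imp_bounded bounded_pos by (metis imageI)
  show thesis
  proof (rule that[of "B + norm L + 1"])
    fix x :: real assume "x \<ge> 0"
    show "norm (S x) \<le> B + norm L + 1"
    proof (cases "x \<le> N")
      case True
      thus ?thesis using B(2)[of x] \<open>x \<ge> 0\<close> norm_ge_zero[of L] unfolding atLeastAtMost_iff by linarith
    next
      case False
      hence "dist (S x) L < 1" using N by simp
      hence "norm (S x) \<le> norm L + 1" using norm_triangle_sub[of "S x" L] by (simp add: dist_norm)
      thus ?thesis using B(1) by simp
    qed
  qed (use B in \<open>simp add: add_pos_nonneg\<close>)
qed

lemma integrable_fejer_mult:
  fixes v :: "real \<Rightarrow> complex"
  assumes v: "continuous_on UNIV v" and vb: "\<And>x. norm (v x) \<le> C" and h: "h > 0"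
  shows "integrable lborel (\<lambda>x. of_real (fejer (h * x)) * v x)"
proof (rule Bochner_Integration.integrable_bound[OF integrable_inverse_1_plus_square_scaled[OF h, of "8 * C"]])
  have [measurable]: "v \<in> borel_measurable borel" by (rule borel_measurable_continuous_onI[OF v])
  show "(\<lambda>x. of_real (fejer (h * x)) * v x) \<in> borel_measurable lborel" by measurable
  show "AE x in lborel. norm (of_real (fejer (h * x)) * v x) \<le> norm (8 * C / (1 + (h * x)\<^sup>2))"
  proof (intro AE_I2)
    fix x
    have "fejer (h * x) * norm (v x) \<le> 8 / (1 + (h * x)\<^sup>2) * C"
      by (intro mult_mono fejer_bounds vb) (auto intro!: divide_nonneg_nonneg)
    moreover have "C \<ge> 0" using norm_ge_zero vb order_trans by blast
    ultimately show "norm (of_real (fejer (h * x)) * v x) \<le> norm (8 * C / (1 + (h * x)\<^sup>2))"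
      using fejer_bounds(1)[of "h * x"] by (auto simp: norm_mult abs_of_nonneg)
  qed
qed

text \<open>Pairing \<open>x\<close> with \<open>- x\<close> means that only symmetric truncations
  of an improper integral enter below.\<close>

lemma integral_lborel_fold:
  fixes f :: "real \<Rightarrow> complex"
  assumes f: "integrable lborel f"
  shows "(LBINT x. f x) = (LBINT x:{0<..}. f x + f (- x))"
proof -
  have [measurable]: "f \<in> borel_measurable borel" using f by auto
  have i: "integrable lborel (\<lambda>x. indicator {0<..} x *\<^sub>R f x)" "integrable lborel (\<lambda>x. indicator {..<0} x *\<^sub>R f x)"
    by (intro integrable_mult_indicator f; simp)+
  have i': "integrable lborel (\<lambda>x. indicator {0<..} x *\<^sub>R f (- x))"
    using lborel_integrable_real_affine[OF i(2), of "-1" 0] by (simp add: indicator_def)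
  have "(LBINT x. f x) = (LBINT x. indicator {0<..} x *\<^sub>R f x + indicator {..<0} x *\<^sub>R f x)"
    by (rule integral_cong_AE) (auto simp: indicator_def intro!: AE_I[where N = "{0}"])
  also have "\<dots> = (LBINT x. indicator {0<..} x *\<^sub>R f x) + (LBINT x. indicator {..<0} x *\<^sub>R f x)"
    using i by (rule Bochner_Integration.integral_add)
  also have "(LBINT x. indicator {..<0} x *\<^sub>R f x) = (LBINT x. indicator {0<..} x *\<^sub>R f (- x))"
    by (subst lborel_integral_real_affine[of "-1" _ 0]) (auto simp: indicator_def intro!: Bochner_Integration.integral_cong)
  finally show ?thesis
    unfolding set_lebesgue_integral_def scaleR_add_right
    using Bochner_Integration.integral_add[OF i(1) i'] by simp
qed

text \<open>Integration by parts turns the Fejer mean into an average of the truncated integrals \<open>S\<close>.\<close>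
lemma fejer_mean_by_parts:
  fixes v S :: "real \<Rightarrow> complex"
  assumes v: "continuous_on UNIV v" and vb: "\<And>x. norm (v x) \<le> C"
    and Sd: "\<And>x. (S has_vector_derivative v x) (at x)" and S0: "S 0 = 0"
    and Sb: "\<And>x. x \<ge> 0 \<Longrightarrow> norm (S x) \<le> M"
    and h: "h > 0"
  shows "(LBINT x:{0<..}. of_real (fejer (h * x)) * v x) =
      - (LBINT z:{0<..}. of_real (fejer' z) * S (z / h))"
proof -
  have Scont: "isCont S x" for x
    using Sd by (rule has_vector_derivative_continuous)
  have [measurable]: "S \<in> borel_measurable borel"
    by (intro borel_measurable_continuous_onI continuous_at_imp_continuous_on ballI Scont)
  have i1: "set_integrable lborel {0<..} (\<lambda>x. of_real (fejer (h * x)) * v x)"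
    using integrable_fejer_mult[OF v vb h] unfolding set_integrable_def
    by (intro integrable_mult_indicator) auto
  have i2: "set_integrable lborel {0<..} (\<lambda>x. of_real (h * fejer' (h * x)) * S x)"
    unfolding set_integrable_def
  proof (rule Bochner_Integration.integrable_bound[OF integrable_inverse_1_plus_square_scaled[OF h, of "h * 20 * M"]])
    show "(\<lambda>x. indicator {0<..} x *\<^sub>R (of_real (h * fejer' (h * x)) * S x)) \<in> borel_measurable lborel"
      by measurable
    show "AE x in lborel. norm (indicator {0<..} x *\<^sub>R (of_real (h * fejer' (h * x)) * S x))
         \<le> norm (h * 20 * M / (1 + (h * x)\<^sup>2))"
    proof (intro AE_I2)
      fix x :: real
      show "norm (indicator {0<..} x *\<^sub>R (of_real (h * fejer' (h * x)) * S x))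
         \<le> norm (h * 20 * M / (1 + (h * x)\<^sup>2))"
      proof (cases "x > 0")
        case True
        have "M \<ge> 0" using order_trans[OF norm_ge_zero Sb[of 0]] by simp
        have "norm (indicator {0<..} x *\<^sub>R (of_real (h * fejer' (h * x)) * S x)) = h * (\<bar>fejer' (h * x)\<bar> * norm (S x))"
          using True h by (simp add: norm_mult abs_mult)
        also have "\<dots> \<le> h * (20 / (1 + (h * x)\<^sup>2) * M)"
          using True h by (intro mult_left_mono mult_mono fejer'_bound Sb) auto
        also have "\<dots> = h * 20 * M / (1 + (h * x)\<^sup>2)" by simp
        also have "\<dots> = norm \<dots>" using h \<open>M \<ge> 0\<close> by simp
        finally show ?thesis .
      qed simp
    qed
  qed
  \<comment> \<open>Both boundary terms vanish: at 0 because \<open>S 0 = 0\<close> while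
    \<open>fejer\<close> is bounded, at infinity because \<open>S\<close> is bounded while
    \<open>fejer\<close> decays.\<close>
  have "(LBINT x=0..\<infinity>. of_real (fejer (h * x)) * v x + of_real (h * fejer' (h * x)) * S x) = 0 - 0"
  proof (rule interval_integral_FTC_integrable[where F = "\<lambda>x. of_real (fejer (h * x)) * S x"])
    fix x :: real assume "0 < ereal x"
    hence x: "x > 0" by simp
    have *: "((\<lambda>x. fejer (h * x)) has_real_derivative fejer' (h * x) * h) (at x)"
      using fejer_deriv[of "h * x"] x h by (intro DERIV_chain2[of fejer] derivative_eq_intros) auto
    show "((\<lambda>x. of_real (fejer (h * x)) * S x) has_vector_derivative
        of_real (fejer (h * x)) * v x + of_real (h * fejer' (h * x)) * S x) (at x)"
      using has_vector_derivative_mult[OF has_vector_derivative_of_real[OF *] Sd]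
      by (simp add: mult.commute)
    have "isCont (\<lambda>x. fejer (h * x)) x" using * by (rule DERIV_isCont)
    moreover have "isCont v x" using v by (simp add: continuous_on_eq_continuous_at)
    moreover have "isCont (\<lambda>x. fejer' (h * x)) x"
      using x h by (intro isCont_o2[OF _ isCont_fejer'] continuous_intros) auto
    ultimately show "isCont (\<lambda>x. of_real (fejer (h * x)) * v x + of_real (h * fejer' (h * x)) * S x) x"
      using Scont by (intro continuous_intros) auto
  next
    show "set_integrable lborel (einterval 0 \<infinity>)
      (\<lambda>x. of_real (fejer (h * x)) * v x + of_real (h * fejer' (h * x)) * S x)"
      unfolding einterval_0_infinity by (intro set_integral_add i1 i2)
    show "(((\<lambda>x. of_real (fejer (h * x)) * S x) \<circ> real_of_ereal) \<longlongrightarrow> 0) (at_right 0)"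
      unfolding zero_ereal_def ereal_tendsto_simps
    proof (rule Lim_null_comparison)
      show "((\<lambda>x. norm (S x)) \<longlongrightarrow> 0) (at_right 0)" 
        using Scont[of 0] S0 by (intro tendsto_norm_zero) (auto simp: isCont_def intro: tendsto_within_subset)
      show "\<forall>\<^sub>F x in at_right 0. norm (of_real (fejer (h * x)) * S x) \<le> norm (S x)"
        using fejer_bounds by (intro always_eventually) (auto simp: norm_mult intro: mult_left_le_one_le)
    qed
    show "(((\<lambda>x. of_real (fejer (h * x)) * S x) \<circ> real_of_ereal) \<longlongrightarrow> 0) (at_left \<infinity>)"
      unfolding ereal_tendsto_simps
    proof (rule Lim_null_comparison)
      have "filterlim (\<lambda>x. h * x) at_top at_top"
        using h by (intro filterlim_tendsto_pos_mult_at_top[OF tendsto_const]) (auto simp: filterlim_ident)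
      hence "((\<lambda>x. fejer (h * x) * M) \<longlongrightarrow> 0 * M) at_top"
        by (intro tendsto_mult tendsto_const filterlim_compose[OF fejer_tendsto_0])
      thus "((\<lambda>x. fejer (h * x) * M) \<longlongrightarrow> 0) at_top" by simp
      show "\<forall>\<^sub>F x in at_top. norm (of_real (fejer (h * x)) * S x) \<le> fejer (h * x) * M"
        using eventually_ge_at_top[of 0]
        by eventually_elim (auto simp: norm_mult fejer_bounds intro!: mult_left_mono Sb)
    qed
  qed auto
  hence "(LBINT x:{0<..}. of_real (fejer (h * x)) * v x) + (LBINT x:{0<..}. of_real (h * fejer' (h * x)) * S x) = 0"
    unfolding interval_lebesgue_integral_def einterval_0_infinity
    using set_integral_add(2)[OF i1 i2] by simp
  moreover have "(LBINT z:{0<..}. of_real (fejer' z) * S (z / h)) = (LBINT x:{0<..}. of_real (h * fejer' (h * x)) * S x)"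
  proof -
    have "(LBINT z:{0<..}. of_real (fejer' z) * S (z / h)) =
        \<bar>h\<bar> *\<^sub>R (LBINT x. indicator {0<..} (0 + h * x) *\<^sub>R (of_real (fejer' (0 + h * x)) * S ((0 + h * x) / h)))"
      unfolding set_lebesgue_integral_def using h by (intro lborel_integral_real_affine) simp
    also have "\<dots> = (LBINT x. \<bar>h\<bar> *\<^sub>R (indicator {0<..} (0 + h * x) *\<^sub>R (of_real (fejer' (0 + h * x)) * S ((0 + h * x) / h))))"
      by (rule integral_scaleR_right[symmetric])
    also have "\<dots> = (LBINT x:{0<..}. of_real (h * fejer' (h * x)) * S x)"
      unfolding set_lebesgue_integral_def using h
      by (intro Bochner_Integration.integral_cong)
         (auto simp: indicator_def zero_less_mult_iff scaleR_conv_of_real)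
    finally show ?thesis .
  qed
  ultimately show ?thesis by (simp add: eq_neg_iff_add_eq_0)
qed

text \<open>Folding and integration by parts turn the mean into the average of
  \<open>S (z / h k)\<close> against \<open>- fejer'\<close>, where \<open>S x\<close> is the
  integral of \<open>w\<close> over \<open>{- x..x}\<close>. Improper convergence gives
  \<open>S\<close> the limit \<open>L\<close>, hence also a uniform bound, and dominated convergence
  applies because the kernel has mass 1.\<close>

lemma fejer_mean_tendsto:
  fixes w :: "real \<Rightarrow> complex"
  assumes w: "continuous_on UNIV w" and wb: "\<And>x. norm (w x) \<le> C"
    and L: "(w has_integral L) UNIV"
    and h: "\<And>k. h k > 0" "h \<longlonglongrightarrow> 0"
  shows "(\<lambda>k. LBINT x. of_real (fejer (h k * x)) * w x) \<longlonglongrightarrow> L"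
proof -
  define v where "v x = w x + w (- x)" for x
  have [measurable]: "w \<in> borel_measurable borel" by (rule borel_measurable_continuous_onI[OF w])
  obtain P where P: "\<And>x. (P has_vector_derivative w x) (at x)"
    using einterval_antiderivative[of "-\<infinity>" \<infinity> w] w by (auto simp: continuous_on_eq_continuous_at)
  define S where "S x = P x - P (- x)" for x
  have vc: "continuous_on UNIV v" unfolding v_def
    by (intro continuous_intros w continuous_on_compose2[OF w]) auto
  have vb: "norm (v x) \<le> 2 * C" for x
    unfolding v_def using norm_triangle_ineq[of "w x" "w (- x)"] wb[of x] wb[of "-x"] by linarith
  have vS: "(S has_vector_derivative v x) (at x)" for x
  proof -
    have "((\<lambda>x. P (- x)) has_vector_derivative (- 1) *\<^sub>R w (- x)) (at x)"
      using vector_diff_chain_at[of uminus "- 1" x P "w (- x)"] P[of "- x"]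
        has_vector_derivative_minus[OF has_vector_derivative_id[of "at x"]]
      by (auto simp: o_def)
    from has_vector_derivative_diff[OF P[of x] this] show ?thesis
      unfolding S_def v_def by simp
  qed
  have S_int: "(w has_integral S x) {- x..x}" if "x \<ge> 0" for x
    unfolding S_def using that P
    by (intro fundamental_theorem_of_calculus) (auto intro: has_vector_derivative_at_within)
  have SL: "(S \<longlongrightarrow> L) at_top"
  proof (rule tendstoI)
    fix e :: real assume "e > 0"
    with L obtain B where B: "B > 0" "\<And>a b. ball 0 B \<subseteq> cbox a b \<Longrightarrow> 
        \<exists>z. ((\<lambda>x. if x \<in> UNIV then w x else 0) has_integral z) (cbox a b) \<and> norm (z - L) < e"
      using iffD1[OF has_integral' L] by blast
    show "\<forall>\<^sub>F x in at_top. dist (S x) L < e"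
      using eventually_ge_at_top[of B]
    proof eventually_elim
      case (elim x)
      hence "ball 0 B \<subseteq> cbox (- x) x" by (auto simp: dist_norm)
      from B(2)[OF this] S_int[of x] B(1) elim show ?case
        by (auto simp: dist_norm dest: has_integral_unique)
    qed
  qed
  have Sc: "continuous_on A S" for A
    by (intro continuous_at_imp_continuous_on ballI has_vector_derivative_continuous[OF vS])
  have [measurable]: "S \<in> borel_measurable borel" by (intro borel_measurable_continuous_onI Sc)
  obtain M where M: "M > 0" "\<And>x. x \<ge> 0 \<Longrightarrow> norm (S x) \<le> M"
    using bounded_if_convergent_at_top[OF Sc SL] by blast
  have "(\<lambda>k. LBINT z. indicator {0<..} z *\<^sub>R (of_real (fejer' z) * S (z / h k)))
      \<longlonglongrightarrow> (LBINT z. indicator {0<..} z *\<^sub>R (of_real (fejer' z) * L))"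
  proof (rule integral_dominated_convergence[where w = "\<lambda>z. indicator {0<..} z * (\<bar>fejer' z\<bar> * M)"])
    show "integrable lborel (\<lambda>z. indicator {0<..} z * (\<bar>fejer' z\<bar> * M))"
      using set_integrable_mult_left[of M, OF set_integrable_abs[OF set_integrable_fejer']]
      by (simp add: set_integrable_def)
    show "AE x in lborel. norm (indicator {0<..} x *\<^sub>R (of_real (fejer' x) * S (x / h k)))
         \<le> indicator {0<..} x * (\<bar>fejer' x\<bar> * M)" for k
      using h(1)[of k] M by (auto simp: indicator_def norm_mult intro!: mult_left_mono)
    show "AE x in lborel. (\<lambda>k. indicator {0<..} x *\<^sub>R (of_real (fejer' x) * S (x / h k)))
        \<longlonglongrightarrow> indicator {0<..} x *\<^sub>R (of_real (fejer' x) * L)"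
    proof (intro AE_I2)
      fix x :: real
      have "(\<lambda>k. S (x / h k)) \<longlonglongrightarrow> L" if "x > 0"
      proof (rule filterlim_compose[OF SL])
        show "filterlim (\<lambda>k. x / h k) at_top sequentially"
          unfolding divide_inverse using that h
          by (intro filterlim_tendsto_pos_mult_at_top[OF tendsto_const] filterlim_inverse_at_top) auto
      qed
      thus "(\<lambda>k. indicator {0<..} x *\<^sub>R (of_real (fejer' x) * S (x / h k)))
        \<longlonglongrightarrow> indicator {0<..} x *\<^sub>R (of_real (fejer' x) * L)"
        by (cases "x > 0") (auto intro!: tendsto_intros)
    qed
  qed measurable
  also have "(LBINT z. indicator {0<..} z *\<^sub>R (of_real (fejer' z) * L)) = - L"
  proof -
    have "(LBINT z. indicator {0<..} z *\<^sub>R (of_real (fejer' z) * L))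
        = (LBINT z. of_real (indicator {0<..} z * fejer' z) * L)"
      by (intro Bochner_Integration.integral_cong) (auto simp: scaleR_conv_of_real)
    also have "\<dots> = of_real (LBINT z:{0<..}. fejer' z) * L"
      unfolding set_lebesgue_integral_def by (simp flip: of_real_mult)
    finally show ?thesis by (simp add: integral_fejer')
  qed
  finally have "(\<lambda>k. - (LBINT z:{0<..}. of_real (fejer' z) * S (z / h k))) \<longlonglongrightarrow> - (- L)"
    unfolding set_lebesgue_integral_def by (rule tendsto_minus)
  moreover have "(LBINT x. of_real (fejer (h k * x)) * w x) = - (LBINT z:{0<..}. of_real (fejer' z) * S (z / h k))" for k
  proof -
    have "(LBINT x. of_real (fejer (h k * x)) * w x) = (LBINT x:{0<..}. of_real (fejer (h k * x)) * v x)"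
      by (subst integral_lborel_fold[OF integrable_fejer_mult[OF w wb h(1)]])
         (simp add: v_def algebra_simps)
    also have "\<dots> = - (LBINT z:{0<..}. of_real (fejer' z) * S (z / h k))"
      by (rule fejer_mean_by_parts[OF vc vb vS _ M(2) h(1)]) (simp_all add: S_def)
    finally show ?thesis .
  qed
  ultimately show ?thesis by simp
qed

section \<open>Riemann's method and Gaussian inversion\<close>

lemma fejer_isCont_0: "isCont fejer 0"
proof -
  have "((\<lambda>z::real. (2 - 2 * cos z) / z\<^sup>2) \<longlongrightarrow> 1) (at 0)" by real_asymp
  hence "(fejer \<longlongrightarrow> 1) (at 0)"
    by (rule Lim_transform_eventually) (auto simp: eventually_at_filter fejer_def)
  thus ?thesis by (simp add: isCont_def fejer_def)
qed

lemma continuous_on_laplace_smooth: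
  fixes V :: "real \<Rightarrow> complex"
  assumes V: "continuous_on UNIV V" and Vb: "\<And>b. norm (V b) \<le> B"
  shows "continuous_on UNIV (laplace_smooth V)"
proof (rule continuous_at_imp_continuous_on, intro ballI)
  fix b
  have [measurable]: "V \<in> borel_measurable borel" by (rule borel_measurable_continuous_onI[OF V])
  \<comment> \<open>The substitution moves \<open>b\<close> from the kernel into \<open>V\<close>,
    so that the majorant \<open>B * laplace_density x\<close> is independent of
    \<open>b\<close>.\<close>
  have eq: "laplace_smooth V b = (LBINT x. of_real (laplace_density x) * V (b - x))" for b
    unfolding laplace_smooth_def by (subst lborel_integral_real_affine[of "-1" _ b]) auto
  have i: "integrable lborel (\<lambda>x. B * laplace_density x)"
    using integrable_laplace_density_translate[of 0] by simp
  have "(\<lambda>n. LBINT x. of_real (laplace_density x) * V (X n - x)) \<longlonglongrightarrow> (LBINT x. of_real (laplace_density x) * V (b - x))"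
    if "X \<longlonglongrightarrow> b" for X
  proof (rule integral_dominated_convergence[OF _ _ i])
    show "AE x in lborel. norm (of_real (laplace_density x) * V (X n - x)) \<le> B * laplace_density x" for n
      by (auto simp: norm_mult mult.commute[of B] intro!: mult_left_mono Vb)
    show "AE x in lborel. (\<lambda>n. of_real (laplace_density x) * V (X n - x)) \<longlonglongrightarrow> of_real (laplace_density x) * V (b - x)"
      using V by (intro AE_I2 tendsto_intros continuous_on_tendsto_compose[OF V] that) auto
  qed measurable
  thus "isCont (laplace_smooth V) b"
    unfolding isCont_def tendsto_at_iff_sequentially o_def eq by blast
qed

text \<open>
  Riemann's method: the absolutely convergent transform \<open>F\<close> of \<open>u x / (1 + x\<^sup>2)\<close> has second
  symmetric derivative \<open>F - V\<close>, and \<open>G = laplace_smooth V\<close> has \<open>G - V\<close>; so \<open>D = F - G\<close> is bounded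
  with \<open>D'' = D\<close>, hence zero.  No integrability of \<open>u\<close> is available.
\<close>
lemma fourier_weighted_eq_laplace_smooth:
  fixes u :: "real \<Rightarrow> real" and V :: "real \<Rightarrow> complex"
  assumes u: "continuous_on UNIV u" and ub: "\<And>x. \<bar>u x\<bar> \<le> C"
    and V: "continuous_on UNIV V" and Vb: "\<And>b. norm (V b) \<le> B"
    and FT: "\<And>b. ((\<lambda>x. iexp (b * x) * of_real (u x)) has_integral V b) UNIV"
  shows "(LBINT x. iexp (b * x) * of_real (u x / (1 + x\<^sup>2))) = laplace_smooth V b"
proof -
  define F where "F b = (LBINT x. iexp (b * x) * of_real (u x / (1 + x\<^sup>2)))" for b
  have [measurable]: "u \<in> borel_measurable borel" by (rule borel_measurable_continuous_onI[OF u])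
  have Vm: "V \<in> borel_measurable borel" by (rule borel_measurable_continuous_onI[OF V])
  have C: "C \<ge> 0" using ub[of 0] by simp
  have Ci: "integrable lborel (\<lambda>x::real. C / (1 + x\<^sup>2))"
    using integrable_inverse_1_plus_square_scaled[of 1 C] by simp
  have ub': "norm (iexp (b * x) * complex_of_real (u x / (1 + x\<^sup>2))) \<le> C / (1 + x\<^sup>2)" for b x
    using ub[of x] by (simp add: norm_mult norm_divide abs_mult divide_right_mono add_pos_nonneg
        del: of_real_divide)
  have Fi: "integrable lborel (\<lambda>x. iexp (b * x) * of_real (u x / (1 + x\<^sup>2)))" for b
  proof (rule Bochner_Integration.integrable_bound[OF Ci])
    show "AE x in lborel. norm (iexp (b * x) * complex_of_real (u x / (1 + x\<^sup>2))) \<le> norm (C / (1 + x\<^sup>2))"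
      unfolding real_norm_def by (intro AE_I2 order_trans[OF ub' abs_ge_self])
  qed measurable
  have Fb: "norm (F b) \<le> (LBINT x. C / (1 + x\<^sup>2))" for b
    unfolding F_def by (rule Bochner_Integration.integral_norm_bound_integral[OF Fi Ci ub'])
  have Fc: "continuous_on UNIV F"
  proof (rule continuous_at_imp_continuous_on, intro ballI)
    fix b
    show "isCont F b"
      unfolding isCont_def tendsto_at_iff_sequentially o_def F_def
    proof (intro allI impI)
      fix X assume X: "\<forall>i. X i \<in> UNIV - {b}" "X \<longlonglongrightarrow> b"
      show "(\<lambda>n. LBINT x. iexp (X n * x) * of_real (u x / (1 + x\<^sup>2)))
          \<longlonglongrightarrow> (LBINT x. iexp (b * x) * of_real (u x / (1 + x\<^sup>2)))"
        by (rule integral_dominated_convergence[OF _ _ Ci]) 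
           (auto intro!: tendsto_intros X AE_I2 ub' simp del: of_real_divide of_real_mult)
    qed
  qed
  define h :: "nat \<Rightarrow> real" where "h k = 1 / (real k + 1)" for k
  have h: "h k > 0" for k by (simp add: h_def)
  have h0: "h \<longlonglongrightarrow> 0" unfolding h_def by real_asymp
  have h_right: "filterlim h (at_right 0) sequentially"
    unfolding filterlim_at using h h0 by (auto simp: less_imp_neq[symmetric])
  have Gb: "norm (laplace_smooth V b) \<le> B" for b by (rule norm_laplace_smooth_le[OF Vm Vb])
  have Gc: "continuous_on UNIV (laplace_smooth V)" by (rule continuous_on_laplace_smooth[OF V Vb])
  have Flim: "(\<lambda>k. (F (b + h k) + F (b - h k) - 2 * F b) / of_real ((h k)\<^sup>2)) \<longlonglongrightarrow> F b - V b" for b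
  proof -
    have e: "iexp ((b + h) * x) + iexp ((b - h) * x) - 2 * iexp (b * x) =
        iexp (b * x) * of_real (- (h * x)\<^sup>2 * fejer (h * x))" for b h x
    proof -
      have "iexp ((b + h) * x) + iexp ((b - h) * x) - 2 * iexp (b * x) =
         iexp (b * x) * (iexp (h * x) + iexp (- (h * x)) - 2)"
      proof -
        have "iexp ((b + h) * x) = iexp (b * x) * iexp (h * x)" "iexp ((b - h) * x) = iexp (b * x) * iexp (- (h * x))"
          by (simp_all only: exp_add[symmetric]) (simp_all add: algebra_simps)
        thus ?thesis by (simp only: algebra_simps)
      qed
      also have "iexp (h * x) + iexp (- (h * x)) - 2 = of_real (2 * cos (h * x) - 2)"
        by (simp only: complex_eq_iff) (simp add: Re_exp Im_exp)
      also have "2 * cos (h * x) - 2 = - (h * x)\<^sup>2 * fejer (h * x)" by (simp add: fejer_def)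
      finally show ?thesis .
    qed
    \<comment> \<open>The second difference multiplies the integrand by -x^2 times the Fejer factor,
      and -x^2 / (1 + x^2) = 1 / (1 + x^2) - 1. The quotient is thus a Fejer mean of the weighted
      function minus one of the unweighted function, with limits \<open>F b\<close> and
      \<open>V b\<close>.\<close>
    have eq: "(F (b + h k) + F (b - h k) - 2 * F b) / of_real ((h k)\<^sup>2) =
       (LBINT x. of_real (fejer (h k * x)) * (iexp (b * x) * of_real (u x / (1 + x\<^sup>2)))) -
       (LBINT x. of_real (fejer (h k * x)) * (iexp (b * x) * of_real (u x)))" for k
    proof -
      have i1: "integrable lborel (\<lambda>x. of_real (fejer (h k * x)) * (iexp (b * x) * of_real (u x / (1 + x\<^sup>2))))"
      proof (rule integrable_fejer_mult[OF _ _ h, where C = C])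
        show "continuous_on UNIV (\<lambda>x. iexp (b * x) * complex_of_real (u x / (1 + x\<^sup>2)))"
          by (intro continuous_intros u) (auto simp: add_nonneg_eq_0_iff)
        have "C / (1 + x\<^sup>2) \<le> C" for x :: real
          using C mult_left_mono[of 1 "1 + x\<^sup>2" C] by (simp add: divide_le_eq add_pos_nonneg)
        thus "norm (iexp (b * x) * complex_of_real (u x / (1 + x\<^sup>2))) \<le> C" for x
          using ub' order_trans by blast
      qed
      have i2: "integrable lborel (\<lambda>x. of_real (fejer (h k * x)) * (iexp (b * x) * of_real (u x)))"
        by (rule integrable_fejer_mult[OF _ _ h, where C = C])
           (use ub in \<open>auto intro!: continuous_intros u simp: norm_mult simp del: of_real_mult\<close>)
      have "F (b + h k) + F (b - h k) - 2 * F b =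
        (LBINT x. iexp ((b + h k) * x) * of_real (u x / (1 + x\<^sup>2)) + iexp ((b - h k) * x) * of_real (u x / (1 + x\<^sup>2))
          - 2 * (iexp (b * x) * of_real (u x / (1 + x\<^sup>2))))"
        unfolding F_def by (subst Bochner_Integration.integral_diff Bochner_Integration.integral_add
          integral_mult_right_zero | intro Bochner_Integration.integrable_add integrable_mult_right Fi refl)+
      also have "\<dots> = (LBINT x. of_real ((h k)\<^sup>2) * (of_real (fejer (h k * x)) * (iexp (b * x) * of_real (u x / (1 + x\<^sup>2))) -
          of_real (fejer (h k * x)) * (iexp (b * x) * of_real (u x))))"
      proof (intro Bochner_Integration.integral_cong refl)
        fix x :: real
        have x: "1 + x\<^sup>2 \<noteq> 0" by (simp add: add_nonneg_eq_0_iff)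
        define E where "E = iexp (b * x)"
        have "iexp ((b + h k) * x) * of_real (u x / (1 + x\<^sup>2)) + iexp ((b - h k) * x) * of_real (u x / (1 + x\<^sup>2))
          - 2 * (iexp (b * x) * of_real (u x / (1 + x\<^sup>2))) = 
          (iexp ((b + h k) * x) + iexp ((b - h k) * x) - 2 * iexp (b * x)) * of_real (u x / (1 + x\<^sup>2))"
          by (simp only: algebra_simps)
        also have "\<dots> = E * of_real (- (h k * x)\<^sup>2 * fejer (h k * x)) * of_real (u x / (1 + x\<^sup>2))"
          unfolding e E_def ..
        also have "\<dots> = E * of_real (- (h k * x)\<^sup>2 * fejer (h k * x) * (u x / (1 + x\<^sup>2)))"
          by (simp only: of_real_mult mult.assoc)
        also have "- (h k * x)\<^sup>2 * fejer (h k * x) * (u x / (1 + x\<^sup>2)) =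
            (h k)\<^sup>2 * (fejer (h k * x) * (u x / (1 + x\<^sup>2)) - fejer (h k * x) * u x)"
          using x by (simp add: field_simps power2_eq_square)
        also have "E * of_real \<dots> = of_real ((h k)\<^sup>2) * (of_real (fejer (h k * x)) * (E * of_real (u x / (1 + x\<^sup>2))) -
          of_real (fejer (h k * x)) * (E * of_real (u x)))"
          by (simp only: of_real_mult of_real_diff) (simp only: algebra_simps)
        finally show "iexp ((b + h k) * x) * of_real (u x / (1 + x\<^sup>2)) + iexp ((b - h k) * x) * of_real (u x / (1 + x\<^sup>2))
          - 2 * (iexp (b * x) * of_real (u x / (1 + x\<^sup>2))) =
          of_real ((h k)\<^sup>2) * (of_real (fejer (h k * x)) * (iexp (b * x) * of_real (u x / (1 + x\<^sup>2))) -
          of_real (fejer (h k * x)) * (iexp (b * x) * of_real (u x)))" unfolding E_def .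
      qed
      also have "\<dots> = of_real ((h k)\<^sup>2) *
       ((LBINT x. of_real (fejer (h k * x)) * (iexp (b * x) * of_real (u x / (1 + x\<^sup>2)))) -
       (LBINT x. of_real (fejer (h k * x)) * (iexp (b * x) * of_real (u x))))"
        unfolding integral_mult_right_zero Bochner_Integration.integral_diff[OF i1 i2] ..
      finally show ?thesis using h[of k] by simp
    qed
    have "(\<lambda>k. LBINT x. of_real (fejer (h k * x)) * (iexp (b * x) * of_real (u x / (1 + x\<^sup>2))))
        \<longlonglongrightarrow> (LBINT x. 1 * (iexp (b * x) * of_real (u x / (1 + x\<^sup>2))))"
    proof (rule integral_dominated_convergence[OF _ _ Ci])
      show "AE x in lborel. norm (of_real (fejer (h k * x)) * (iexp (b * x) * of_real (u x / (1 + x\<^sup>2)))) \<le> C / (1 + x\<^sup>2)" for k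
      proof (intro AE_I2)
        fix x
        show "norm (of_real (fejer (h k * x)) * (iexp (b * x) * of_real (u x / (1 + x\<^sup>2)))) \<le> C / (1 + x\<^sup>2)"
          unfolding norm_mult[of "of_real (fejer (h k * x))"]
          by (rule order_trans[OF mult_left_le_one_le ub']) (auto simp: fejer_bounds)
      qed
      show "AE x in lborel. (\<lambda>k. of_real (fejer (h k * x)) * (iexp (b * x) * of_real (u x / (1 + x\<^sup>2))))
        \<longlonglongrightarrow> 1 * (iexp (b * x) * of_real (u x / (1 + x\<^sup>2)))"
      proof (intro AE_I2 tendsto_mult tendsto_const)
        fix x :: real
        have "isCont fejer 0" using fejer_isCont_0 .
        moreover have "(\<lambda>k. h k * x) \<longlonglongrightarrow> 0" using tendsto_mult_left_zero[OF h0] .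
        ultimately have "(\<lambda>k. fejer (h k * x)) \<longlonglongrightarrow> fejer 0" by (rule isCont_tendsto_compose)
        thus "(\<lambda>k. complex_of_real (fejer (h k * x))) \<longlonglongrightarrow> 1"
          using tendsto_of_real[of _ 1] by (simp add: fejer_def)
      qed
    qed measurable
    moreover have "(\<lambda>k. LBINT x. of_real (fejer (h k * x)) * (iexp (b * x) * of_real (u x))) \<longlonglongrightarrow> V b"
      by (rule fejer_mean_tendsto[OF _ _ FT h h0, where C = C])
         (use ub in \<open>auto intro!: continuous_intros u simp: norm_mult simp del: of_real_mult\<close>)
    ultimately show ?thesis unfolding eq unfolding F_def mult_1_left by (rule tendsto_diff)
  qed
  have Glim: "(\<lambda>k. (laplace_smooth V (b + h k) + laplace_smooth V (b - h k) - 2 * laplace_smooth V b) / of_real ((h k)\<^sup>2))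
      \<longlonglongrightarrow> laplace_smooth V b - V b" for b
    by (rule filterlim_compose[OF laplace_smooth_second_derivative[OF V Vb] h_right])
  have "F b - laplace_smooth V b = 0"
  \<comment> \<open>The term \<open>V b\<close> occurs in both limits and cancels, so the difference
    reproduces itself.\<close>
  proof (rule second_difference_eq_zero[where h = h and D = "\<lambda>b. F b - laplace_smooth V b"])
    show "continuous_on UNIV (\<lambda>b. F b - laplace_smooth V b)" by (intro continuous_intros Fc Gc)
    show "norm (F b - laplace_smooth V b) \<le> (LBINT x. C / (1 + x\<^sup>2)) + B" for b
      by (rule norm_triangle_le_diff[OF add_mono[OF Fb Gb]])
    show "(\<lambda>k. (F (b + h k) - laplace_smooth V (b + h k) + (F (b - h k) - laplace_smooth V (b - h k))
        - 2 * (F b - laplace_smooth V b)) / of_real ((h k)\<^sup>2)) \<longlonglongrightarrow> F b - laplace_smooth V b" for b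
    proof -
      have "F b - laplace_smooth V b = F b - V b - (laplace_smooth V b - V b)" by simp
      moreover note tendsto_diff[OF Flim[of b] Glim[of b]]
      ultimately show ?thesis
        by (simp add: diff_divide_distrib add_divide_distrib algebra_simps)
    qed
  qed (rule h)
  thus ?thesis by (simp add: F_def)
qed

section \<open>Gaussian summation of Fourier integrals\<close>

lemma integrable_lborel_pair_bound:
  fixes G :: "real \<Rightarrow> real \<Rightarrow> 'b :: {banach, second_countable_topology}" and f g :: "real \<Rightarrow> real"
  assumes G [measurable]: "case_prod G \<in> borel_measurable (lborel \<Otimes>\<^sub>M lborel)"
    and f: "integrable lborel f" and g: "integrable lborel g"
    and bound: "\<And>x y. norm (G x y) \<le> f x * g y"
  shows "integrable (lborel \<Otimes>\<^sub>M lborel) (case_prod G)"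
proof (rule lborel_pair.Fubini_integrable[OF G])
  have Gx [measurable]: "G x \<in> borel_measurable lborel" for x
    using measurable_compose_Pair1[OF _ G, of x] by simp
  have int: "integrable lborel (G x)" for x
  proof (rule Bochner_Integration.integrable_bound[OF integrable_mult_right[OF g]])
    show "AE y in lborel. norm (G x y) \<le> norm (f x * g y)"
      by (intro AE_I2 order_trans[OF bound]) simp
  qed simp
  show "AE x in lborel. integrable lborel (\<lambda>y. case (x, y) of (x, y) \<Rightarrow> G x y)"
    using int by simp
  show "integrable lborel (\<lambda>x. LBINT y. norm (case (x, y) of (x, y) \<Rightarrow> G x y))"
  proof (rule Bochner_Integration.integrable_bound[OF integrable_mult_left[OF f, of "LBINT y. g y"]])
    show "AE x in lborel. norm (LBINT y. norm (case (x, y) of (x, y) \<Rightarrow> G x y)) \<le> norm (f x * (LBINT y. g y))"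
    proof (intro AE_I2)
      fix x
      have "(LBINT y. norm (G x y)) \<le> (LBINT y. f x * g y)"
        by (intro integral_mono integrable_norm int integrable_mult_right g bound)
      moreover have "(LBINT y. norm (G x y)) \<ge> 0" by simp
      ultimately show "norm (LBINT y. norm (case (x, y) of (x, y) \<Rightarrow> G x y)) \<le> norm (f x * (LBINT y. g y))"
        by simp
    qed
  qed measurable
qed

text \<open>A dilation by \<open>\<sigma>\<close> of the characteristic function of the standard
  normal law. The value is written with a normal density so that the factor \<open>2 * pi\<close> of
  Fourier inversion stands apart.\<close>

lemma has_bochner_integral_gaussian_fourier:
  assumes "\<sigma> > 0"
  shows "has_bochner_integral lborel (\<lambda>b. iexp (b * t) * of_real (exp (- (\<sigma> * b)\<^sup>2 / 2)))
    (of_real (2 * pi * (std_normal_density (t / \<sigma>) / \<sigma>)))"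
proof -
  have i: "integrable lborel (\<lambda>b. iexp (s * b) * of_real (std_normal_density b))" for s
    by (rule Bochner_Integration.integrable_bound[where f = std_normal_density])
       (auto simp: norm_mult simp del: of_real_mult)
  have v: "(LBINT b. iexp (s * b) * of_real (std_normal_density b)) = of_real (exp (- s\<^sup>2 / 2))" for s
  proof -
    have "char std_normal_distribution s = (LBINT b. std_normal_density b *\<^sub>R iexp (s * b))"
      unfolding char_def by (intro integral_density) auto
    thus ?thesis by (simp add: char_std_normal_distribution scaleR_conv_of_real mult.commute)
  qed
  have "has_bochner_integral lborel (\<lambda>b. iexp (t / \<sigma> * b) * of_real (std_normal_density b))
     (\<bar>\<sigma>\<bar> *\<^sub>R (of_real (exp (- (t / \<sigma>)\<^sup>2 / 2)) /\<^sub>R \<sigma>))"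
    using i[of "t / \<sigma>"] v[of "t / \<sigma>"] assms by (simp add: has_bochner_integral_iff)
  hence "has_bochner_integral lborel (\<lambda>b. iexp (t / \<sigma> * (0 + \<sigma> * b)) * of_real (std_normal_density (0 + \<sigma> * b)))
     (of_real (exp (- (t / \<sigma>)\<^sup>2 / 2)) /\<^sub>R \<sigma>)"
    using assms by (subst (asm) lborel_has_bochner_integral_real_affine_iff[of \<sigma> _ _ 0]) (simp_all add: divideR_right)
  hence "has_bochner_integral lborel (\<lambda>b. of_real (sqrt (2 * pi)) * (iexp (t / \<sigma> * (0 + \<sigma> * b)) * of_real (std_normal_density (0 + \<sigma> * b))))
     (of_real (sqrt (2 * pi)) * (of_real (exp (- (t / \<sigma>)\<^sup>2 / 2)) /\<^sub>R \<sigma>))"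
    by (intro has_bochner_integral_mult_right)
  also have "(\<lambda>b. of_real (sqrt (2 * pi)) * (iexp (t / \<sigma> * (0 + \<sigma> * b)) * of_real (std_normal_density (0 + \<sigma> * b))))
      = (\<lambda>b. iexp (b * t) * of_real (exp (- (\<sigma> * b)\<^sup>2 / 2)))"
    using assms by (auto simp: std_normal_density_def fun_eq_iff mult.commute real_sqrt_mult)
  also have "of_real (sqrt (2 * pi)) * (complex_of_real (exp (- (t / \<sigma>)\<^sup>2 / 2)) /\<^sub>R \<sigma>) =
      of_real (2 * pi * (std_normal_density (t / \<sigma>) / \<sigma>))"
  proof -
    have "2 * pi * (std_normal_density (t / \<sigma>) / \<sigma>) = sqrt (2 * pi) * (exp (- (t / \<sigma>)\<^sup>2 / 2) / \<sigma>)"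
      
    proof -
      have "2 * pi * (1 / sqrt (2 * pi) * E / \<sigma>) = 2 * pi / sqrt (2 * pi) * (E / \<sigma>)" for E
        by (simp only: times_divide_eq_right times_divide_eq_left mult_1_left)
      moreover have "2 * pi / sqrt (2 * pi) = sqrt (2 * pi)" by (rule real_div_sqrt) simp
      ultimately show ?thesis unfolding std_normal_density_def by simp
    qed
    thus ?thesis by (simp only: scaleR_conv_of_real of_real_mult of_real_divide of_real_inverse divide_inverse mult_ac)
  qed
  finally show ?thesis .
qed

text \<open>Fourier inversion before the limit \<open>\<sigma>\<close> to 0. The Gaussian cutoff
  makes the double integral absolutely convergent, so Fubini holds even when the transform of
  \<open>f\<close> is not integrable.\<close>

lemma fourier_gaussian_mean:
  fixes f :: "real \<Rightarrow> complex"
  assumes f: "integrable lborel f" and \<sigma>: "\<sigma> > 0"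
  shows "(LBINT b. iexp (- (b * x)) * of_real (exp (- (\<sigma> * b)\<^sup>2 / 2)) * (LBINT y. iexp (b * y) * f y)) =
    of_real (2 * pi) * (LBINT z. of_real (std_normal_density z) * f (x + \<sigma> * z))"
proof -
  have [measurable]: "f \<in> borel_measurable borel" using f by auto
  define G where "G b y = iexp (b * (y - x)) * of_real (exp (- (\<sigma> * b)\<^sup>2 / 2)) * f y" for b y
  have k: "integrable lborel (\<lambda>b. exp (- (\<sigma> * b)\<^sup>2 / 2))"
    using integrable_norm[OF has_bochner_integral_gaussian_fourier[OF \<sigma>, of 0, THEN integrable.intros]]
    by (simp del: of_real_exp)
  have "integrable (lborel \<Otimes>\<^sub>M lborel) (case_prod G)"
  proof (rule integrable_lborel_pair_bound[OF _ k integrable_norm[OF f]])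
    show "case_prod G \<in> borel_measurable (lborel \<Otimes>\<^sub>M lborel)" unfolding G_def by measurable
    show "norm (G b y) \<le> exp (- (\<sigma> * b)\<^sup>2 / 2) * norm (f y)" for b y
      unfolding G_def norm_mult
      by (simp only: norm_exp_i_times norm_of_real mult_1_left abs_exp_cancel order_refl)
  qed
  from lborel_pair.Fubini_integral[OF this]
  have "(LBINT b. LBINT y. G b y) = (LBINT y. LBINT b. G b y)" by (rule sym)
  moreover have "(LBINT y. G b y) = iexp (- (b * x)) * of_real (exp (- (\<sigma> * b)\<^sup>2 / 2)) * (LBINT y. iexp (b * y) * f y)" for b
  proof -
    have "iexp (b * (y - x)) = iexp (- (b * x)) * iexp (b * y)" for y
      by (simp only: exp_add[symmetric]) (simp add: algebra_simps)
    hence "G b y = iexp (- (b * x)) * of_real (exp (- (\<sigma> * b)\<^sup>2 / 2)) * (iexp (b * y) * f y)" for y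
      unfolding G_def by (simp only: mult_ac)
    thus ?thesis by (simp only: integral_mult_right_zero)
  qed
  moreover have "(LBINT b. G b y) = of_real (2 * pi) * (of_real (std_normal_density ((y - x) / \<sigma>) / \<sigma>) * f y)" for y
  proof -
    have "(LBINT b. G b y) = of_real (2 * pi * (std_normal_density ((y - x) / \<sigma>) / \<sigma>)) * f y"
      using has_bochner_integral_gaussian_fourier[OF \<sigma>, of "y - x"] 
      unfolding G_def by (simp only: integral_mult_left_zero has_bochner_integral_iff)
    thus ?thesis by (simp only: of_real_mult mult.assoc)
  qed
  moreover have "(LBINT y. of_real (std_normal_density ((y - x) / \<sigma>) / \<sigma>) * f y) = (LBINT z. of_real (std_normal_density z) * f (x + \<sigma> * z))"
  proof -
    have "(LBINT y. of_real (std_normal_density ((y - x) / \<sigma>) / \<sigma>) * f y) = 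
      \<bar>\<sigma>\<bar> *\<^sub>R (LBINT z. of_real (std_normal_density ((x + \<sigma> * z - x) / \<sigma>) / \<sigma>) * f (x + \<sigma> * z))"
      using \<sigma> by (intro lborel_integral_real_affine) simp
    also have "\<dots> = (LBINT z. \<bar>\<sigma>\<bar> *\<^sub>R (of_real (std_normal_density ((x + \<sigma> * z - x) / \<sigma>) / \<sigma>) * f (x + \<sigma> * z)))"
      by (rule integral_scaleR_right[symmetric])
    also have "\<dots> = (LBINT z. of_real (std_normal_density z) * f (x + \<sigma> * z))"
      using \<sigma> by (intro Bochner_Integration.integral_cong refl) (simp add: scaleR_conv_of_real)
    finally show ?thesis .
  qed
  ultimately show ?thesis by (simp only: integral_mult_right_zero)
qed

lemma norm_gaussian_mean_le:
  fixes f :: "real \<Rightarrow> complex"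
  assumes [measurable]: "f \<in> borel_measurable borel" and f: "\<And>x. norm (f x) \<le> C"
  shows "norm (LBINT z. of_real (std_normal_density z) * f (x + \<sigma> * z)) \<le> C"
proof -
  have "norm (LBINT z. of_real (std_normal_density z) * f (x + \<sigma> * z)) \<le> (LBINT z. std_normal_density z * C)"
  proof (rule Bochner_Integration.integral_norm_bound_integral)
    show b: "norm (of_real (std_normal_density z) * f (x + \<sigma> * z)) \<le> std_normal_density z * C" for z
      by (auto simp: norm_mult intro!: mult_left_mono f)
    show "integrable lborel (\<lambda>z. std_normal_density z * C)" by simp
    thus "integrable lborel (\<lambda>z. of_real (std_normal_density z) * f (x + \<sigma> * z))"
      by (rule Bochner_Integration.integrable_bound) (auto intro!: AE_I2 order_trans[OF b])
  qed
  thus ?thesis by simp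
qed

lemma gaussian_mean_tendsto:
  fixes f :: "real \<Rightarrow> complex"
  assumes f: "continuous_on UNIV f" and fb: "\<And>x. norm (f x) \<le> C" and \<sigma>: "\<sigma> \<longlonglongrightarrow> 0"
  shows "(\<lambda>k. LBINT z. of_real (std_normal_density z) * f (x + \<sigma> k * z)) \<longlonglongrightarrow> f x"
proof -
  have [measurable]: "f \<in> borel_measurable borel" by (rule borel_measurable_continuous_onI[OF f])
  have "(\<lambda>k. LBINT z. of_real (std_normal_density z) * f (x + \<sigma> k * z)) \<longlonglongrightarrow>
      (LBINT z. of_real (std_normal_density z) * f x)"
  proof (rule integral_dominated_convergence[where w = "\<lambda>z. std_normal_density z * C"])
    show "AE z in lborel. norm (of_real (std_normal_density z) * f (x + \<sigma> k * z)) \<le> std_normal_density z * C" for k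
      by (auto simp: norm_mult intro!: mult_left_mono fb)
    show "AE z in lborel. (\<lambda>k. of_real (std_normal_density z) * f (x + \<sigma> k * z)) \<longlonglongrightarrow> of_real (std_normal_density z) * f x"
    proof (intro AE_I2 tendsto_intros continuous_on_tendsto_compose[OF f])
      fix z :: real
      show "(\<lambda>k. x + \<sigma> k * z) \<longlonglongrightarrow> x" using tendsto_add[OF tendsto_const tendsto_mult_left_zero[OF \<sigma>]] by force
    qed auto
  qed auto
  thus ?thesis by simp
qed

section \<open>The fundamental solution\<close>

text \<open>For an improper integral the substitution is carried out on boxes: a box that contains
  the ball of radius \<open>B / m\<close> becomes, after scaling by \<open>m\<close>, one that
  contains the ball of radius \<open>B\<close>.\<close>

lemma has_integral_UNIV_dilate:
  fixes f :: "real \<Rightarrow> 'a :: banach"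
  assumes f: "(f has_integral i) UNIV" and m: "m > 0"
  shows "((\<lambda>x. f (m * x)) has_integral (i /\<^sub>R m)) UNIV"
  unfolding has_integral'[of _ _ UNIV]
proof (intro allI impI)
  fix e :: real assume "e > 0"
  hence "e * m > 0" using m by simp
  then obtain B where B: "B > 0" "\<And>a b. ball 0 B \<subseteq> cbox a b \<Longrightarrow>
        \<exists>z. ((\<lambda>x. if x \<in> UNIV then f x else 0) has_integral z) (cbox a b) \<and> norm (z - i) < e * m"
    using iffD1[OF has_integral' f] by blast
  show "\<exists>B>0. \<forall>a b. ball 0 B \<subseteq> cbox a b \<longrightarrow>
     (\<exists>z. ((\<lambda>x. if x \<in> UNIV then f (m * x) else 0) has_integral z) (cbox a b) \<and> norm (z - i /\<^sub>R m) < e)"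
  proof (intro exI[of _ "B / m"] conjI allI impI)
    fix a b :: real assume ab: "ball 0 (B / m) \<subseteq> cbox a b"
    have "ball 0 B \<subseteq> cbox (m * a) (m * b)"
    proof
      fix x :: real assume "x \<in> ball 0 B"
      hence "x / m \<in> ball 0 (B / m)" using m by (simp add: dist_norm divide_strict_right_mono)
      hence "x / m \<in> cbox a b" using ab by blast
      thus "x \<in> cbox (m * a) (m * b)" using m by (simp add: field_simps)
    qed
    from B(2)[OF this] obtain z where z: "(f has_integral z) (cbox (m * a) (m * b))" "norm (z - i) < e * m"
      by auto
    from has_integral_affinity'[OF z(1), of m 0]
    have "((\<lambda>x. f (m * x)) has_integral (z /\<^sub>R m)) (cbox (m * a /\<^sub>R m) (m * b /\<^sub>R m))" using m by simp
    hence "((\<lambda>x. f (m * x)) has_integral (z /\<^sub>R m)) (cbox a b)" using m by (simp add: field_simps)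
    moreover have "norm (z /\<^sub>R m - i /\<^sub>R m) < e"
      using z(2) m by (simp flip: scaleR_diff_right) (simp add: field_simps)
    ultimately show "\<exists>z. ((\<lambda>x. if x \<in> UNIV then f (m * x) else 0) has_integral z) (cbox a b) \<and> norm (z - i /\<^sub>R m) < e"
      by auto
  qed (use B m in simp)
qed

text \<open>The argument is the symbol \<open>V\<close> and not the function \<open>u\<close> behind
  it. It is linear in \<open>V\<close>, so mixing symbols mixes its values, and the Gaussian factor
  makes it converge for bounded \<open>V\<close>.\<close>

definition gaussian_regularisation :: "(real \<Rightarrow> complex) \<Rightarrow> real \<Rightarrow> real \<Rightarrow> complex" where
  "gaussian_regularisation V x \<sigma> =
    (LBINT b. iexp (- (b * x)) * of_real (exp (- (\<sigma> * b)\<^sup>2 / 2)) * laplace_smooth V b)"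

context
  fixes u :: "real \<Rightarrow> real" and V :: "real \<Rightarrow> complex" and C B :: real
  assumes u: "continuous_on UNIV u" and ub: "\<And>x. \<bar>u x\<bar> \<le> C"
    and V: "continuous_on UNIV V" and Vb: "\<And>b. norm (V b) \<le> B"
    and FT: "\<And>b. ((\<lambda>x. iexp (b * x) * of_real (u x)) has_integral V b) UNIV"
begin

lemma weighted_continuous: "continuous_on UNIV (\<lambda>x. complex_of_real (u x / (1 + x\<^sup>2)))"
  by (intro continuous_intros u) (auto simp: add_nonneg_eq_0_iff)

lemma norm_weighted_le: "norm (complex_of_real (u x / (1 + x\<^sup>2))) \<le> C / (1 + x\<^sup>2)"
  unfolding norm_of_real using ub[of x] by (simp add: abs_mult divide_right_mono add_pos_nonneg)

lemma norm_weighted_le': "norm (complex_of_real (u x / (1 + x\<^sup>2))) \<le> C"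
proof -
  have "C \<ge> 0" using ub[of 0] by simp
  hence "C / (1 + x\<^sup>2) \<le> C"
    using mult_left_mono[of 1 "1 + x\<^sup>2" C] by (simp add: divide_le_eq add_pos_nonneg)
  thus ?thesis using norm_weighted_le[of x] by linarith
qed

text \<open>By Riemann's method \<open>laplace_smooth V\<close> is the absolutely convergent
  transform of \<open>u x / (1 + x\<^sup>2)\<close>, to which the Gaussian form of inversion
  applies.\<close>

lemma gaussian_regularisation_eq:
  assumes "\<sigma> > 0"
  shows "gaussian_regularisation V x \<sigma> = of_real (2 * pi) *
    (LBINT z. of_real (std_normal_density z) * of_real (u (x + \<sigma> * z) / (1 + (x + \<sigma> * z)\<^sup>2)))"
proof -
  have "integrable lborel (\<lambda>x. complex_of_real (u x / (1 + x\<^sup>2)))"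
  proof (rule Bochner_Integration.integrable_bound)
    show "integrable lborel (\<lambda>x::real. C / (1 + x\<^sup>2))"
      using integrable_inverse_1_plus_square_scaled[of 1 C] by simp
    show "(\<lambda>x. complex_of_real (u x / (1 + x\<^sup>2))) \<in> borel_measurable lborel"
      using borel_measurable_continuous_onI[OF weighted_continuous] by simp
    show "AE x in lborel. norm (complex_of_real (u x / (1 + x\<^sup>2))) \<le> norm (C / (1 + x\<^sup>2))"
      unfolding real_norm_def by (intro AE_I2 order_trans[OF norm_weighted_le abs_ge_self])
  qed
  from fourier_gaussian_mean[OF this assms, of x]
  show ?thesis
    unfolding gaussian_regularisation_def fourier_weighted_eq_laplace_smooth[OF u ub V Vb FT] .
qed

text \<open>The bound is inherited from \<open>u\<close> and is uniform in \<open>\<sigma>\<close>;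
  for \<open>u\<close> at time \<open>s\<close> it later provides the majorant as a function of
  \<open>s\<close>.\<close>

lemma norm_gaussian_regularisation_le:
  assumes "\<sigma> > 0"
  shows "norm (gaussian_regularisation V x \<sigma>) \<le> 2 * pi * C"
proof -
  have "norm (LBINT z. of_real (std_normal_density z) * complex_of_real (u (x + \<sigma> * z) / (1 + (x + \<sigma> * z)\<^sup>2))) \<le> C"
    by (intro norm_gaussian_mean_le[where f = "\<lambda>x. complex_of_real (u x / (1 + x\<^sup>2))"]
        borel_measurable_continuous_onI weighted_continuous norm_weighted_le')
  thus ?thesis unfolding gaussian_regularisation_eq[OF assms] norm_mult by simp
qed

lemma gaussian_regularisation_tendsto:
  assumes "\<And>k. \<sigma> k > 0" "\<sigma> \<longlonglongrightarrow> 0"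
  shows "(\<lambda>k. gaussian_regularisation V x (\<sigma> k)) \<longlonglongrightarrow> of_real (2 * pi) * of_real (u x / (1 + x\<^sup>2))"
  unfolding gaussian_regularisation_eq[OF assms(1)]
  by (intro tendsto_mult tendsto_const
      gaussian_mean_tendsto[OF weighted_continuous norm_weighted_le' assms(2)])

end

text \<open>Both functions, weighted by \<open>1 / (1 + x\<^sup>2)\<close>, are limits of the same
  regularisations of \<open>V\<close>. Continuity gives equality at every point.\<close>

lemma improper_fourier_unique:
  fixes u1 u2 :: "real \<Rightarrow> real" and V :: "real \<Rightarrow> complex"
  assumes u1: "continuous_on UNIV u1" "\<And>x. \<bar>u1 x\<bar> \<le> C1"
    "\<And>b. ((\<lambda>x. iexp (b * x) * of_real (u1 x)) has_integral V b) UNIV"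
    and u2: "continuous_on UNIV u2" "\<And>x. \<bar>u2 x\<bar> \<le> C2"
    "\<And>b. ((\<lambda>x. iexp (b * x) * of_real (u2 x)) has_integral V b) UNIV"
    and V: "continuous_on UNIV V" "\<And>b. norm (V b) \<le> B"
  shows "u1 x = u2 x"
proof -
  define \<sigma> :: "nat \<Rightarrow> real" where "\<sigma> k = 1 / (real k + 1)" for k
  have \<sigma>: "\<sigma> k > 0" for k by (simp add: \<sigma>_def)
  have \<sigma>0: "\<sigma> \<longlonglongrightarrow> 0" unfolding \<sigma>_def by real_asymp
  have "of_real (2 * pi) * complex_of_real (u1 x / (1 + x\<^sup>2)) = of_real (2 * pi) * complex_of_real (u2 x / (1 + x\<^sup>2))"
    using gaussian_regularisation_tendsto[OF u1(1,2) V u1(3) \<sigma> \<sigma>0, of x]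
      gaussian_regularisation_tendsto[OF u2(1,2) V u2(3) \<sigma> \<sigma>0, of x]
    by (rule LIMSEQ_unique)
  hence "u1 x / (1 + x\<^sup>2) = u2 x / (1 + x\<^sup>2)"
    by (metis mult_cancel_left of_real_eq_iff of_real_eq_0_iff mult_eq_0_iff pi_neq_zero zero_neq_numeral)
  moreover have "1 + x\<^sup>2 \<noteq> 0" by (simp add: add_nonneg_eq_0_iff)
  ultimately show ?thesis by simp
qed

section \<open>Scaling of the generalised Airy function\<close>

definition dispersive_symbol :: "nat \<Rightarrow> real \<Rightarrow> real \<Rightarrow> complex" where
  "dispersive_symbol n s b = exp (- \<i> * complex_of_real (s * b ^ (2 * n + 1)))"

lemma norm_dispersive_symbol: "norm (dispersive_symbol n s b) \<le> 1"
  by (simp add: dispersive_symbol_def)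

lemma continuous_dispersive_symbol: "continuous_on UNIV (dispersive_symbol n s)"
  unfolding dispersive_symbol_def[abs_def] by (intro continuous_intros)

lemma fundamental_solutionD:
  assumes "fundamental_solution n u" "s > 0"
  shows "continuous_on UNIV (\<lambda>x. u x s)" "\<exists>C. \<forall>x. \<bar>u x s\<bar> \<le> C"
    "((\<lambda>x. iexp (b * x) * of_real (u x s)) has_integral dispersive_symbol n s b) UNIV"
  using assms unfolding fundamental_solution_def dispersive_symbol_def bounded_iff
  by (auto simp del: of_real_mult)

text \<open>Both sides have the improper transform \<open>dispersive_symbol n s\<close>, because
  \<open>c ^ (2 * n + 1) = 1 / s\<close>, and so agree by uniqueness. This ties together the
  separate bounds for each \<open>s\<close>: the supremum of \<open>u\<close> at time
  \<open>s\<close> is at most \<open>c\<close> times that at time 1.\<close>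

lemma fundamental_solution_scaling:
  assumes u: "fundamental_solution n u" and s: "s > 0"
  defines "c \<equiv> s powr (- (1 / real (2 * n + 1)))"
  shows "u x s = c * u (c * x) 1"
proof -
  have c: "c > 0" using s by (simp add: c_def)
  have cN: "c ^ (2 * n + 1) = 1 / s"
  proof -
    have "c ^ (2 * n + 1) = c powr real (2 * n + 1)" using c by (simp only: powr_realpow)
    also have "\<dots> = s powr (- (1 / real (2 * n + 1)) * real (2 * n + 1))"
      unfolding c_def by (rule powr_powr)
    also have "- (1 / real (2 * n + 1)) * real (2 * n + 1) = - 1"
      by (simp del: of_nat_add of_nat_mult of_nat_Suc)
    finally show ?thesis using s by (simp add: powr_minus divide_inverse)
  qed
  obtain C1 where C1: "\<And>x. \<bar>u x 1\<bar> \<le> C1" using fundamental_solutionD(2)[OF u, of 1] by auto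
  obtain C2 where C2: "\<And>x. \<bar>u x s\<bar> \<le> C2" using fundamental_solutionD(2)[OF u s] by auto
  show ?thesis
  proof (rule improper_fourier_unique[where V = "dispersive_symbol n s" and B = 1 and ?C1.0 = C2 and ?C2.0 = "c * C1"
        and ?u1.0 = "\<lambda>x. u x s" and ?u2.0 = "\<lambda>x. c * u (c * x) 1"])
    show "continuous_on UNIV (\<lambda>x. c * u (c * x) 1)"
      by (intro continuous_intros continuous_on_compose2[OF fundamental_solutionD(1)[OF u, of 1]]) auto
    show "\<bar>c * u (c * x) 1\<bar> \<le> c * C1" for x
      using C1[of "c * x"] c by (simp add: abs_mult)
    fix b
    have "((\<lambda>x. iexp (b / c * x) * of_real (u x 1)) has_integral dispersive_symbol n 1 (b / c)) UNIV"
      by (rule fundamental_solutionD(3)[OF u]) simp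
    from has_integral_UNIV_dilate[OF this c]
    have "((\<lambda>x. iexp (b * x) * of_real (u (c * x) 1)) has_integral dispersive_symbol n 1 (b / c) /\<^sub>R c) UNIV"
      using c by simp
    from has_integral_mult_right[OF this, of "of_real c"]
    have "((\<lambda>x. of_real c * (iexp (b * x) * of_real (u (c * x) 1))) has_integral
        of_real c * (dispersive_symbol n 1 (b / c) /\<^sub>R c)) UNIV" .
    also have "of_real c * (dispersive_symbol n 1 (b / c) /\<^sub>R c) = dispersive_symbol n 1 (b / c)"
      using c by (simp add: scaleR_conv_of_real mult.assoc[symmetric])
    also have "(\<lambda>x. of_real c * (iexp (b * x) * of_real (u (c * x) 1))) =
        (\<lambda>x. iexp (b * x) * of_real (c * u (c * x) 1))"
      by (simp add: mult_ac)
    finally have "((\<lambda>x. iexp (b * x) * of_real (c * u (c * x) 1)) has_integral dispersive_symbol n 1 (b / c)) UNIV" .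
    also have "dispersive_symbol n 1 (b / c) = dispersive_symbol n s b"
      using s cN by (simp add: dispersive_symbol_def power_divide mult_ac)
    finally show "((\<lambda>x. iexp (b * x) * of_real (c * u (c * x) 1)) has_integral dispersive_symbol n s b) UNIV" .
  qed (rule fundamental_solutionD[OF u s] C2 continuous_dispersive_symbol norm_dispersive_symbol)+
qed

section \<open>The stable subordinator\<close>

text \<open>One fixed \<open>r\<close>, and the density extended by 0 to the whole line, so that set
  integrals become plain Lebesgue integrals.\<close>

definition stable_density :: "real \<Rightarrow> real \<Rightarrow> (real \<Rightarrow> real) \<Rightarrow> bool" where
  "stable_density \<alpha> r g \<longleftrightarrow> (\<forall>s. 0 \<le> g s) \<and> (\<forall>s\<le>0. g s = 0) \<and> integrable lborel g \<and>
     (\<forall>l\<ge>0. (LBINT s. exp (- l * s) * g s) = exp (- r * l powr \<alpha>))"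

lemma stable_density_if_stable_subordinator_density:
  assumes "stable_subordinator_density \<alpha> h" "r > 0"
  shows "stable_density \<alpha> r (\<lambda>s. indicator {0<..} s * h s r)"
proof -
  have "set_integrable lborel {0<..} (\<lambda>s. exp (- 0 * s) * h s r)"
    using assms unfolding stable_subordinator_density_def by blast
  moreover have "(LBINT s. exp (- l * s) * (indicator {0<..} s * h s r)) = exp (- r * l powr \<alpha>)" if "l \<ge> 0" for l
  proof -
    have "(LBINT s. exp (- l * s) * (indicator {0<..} s * h s r)) = (LBINT s:{0<..}. exp (- l * s) * h s r)"
      unfolding set_lebesgue_integral_def by (intro Bochner_Integration.integral_cong) auto
    thus ?thesis using assms that unfolding stable_subordinator_density_def by simp
  qed
  ultimately show ?thesis using assms
    unfolding stable_density_def stable_subordinator_density_def set_integrable_def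
    by (auto simp: indicator_def)
qed

text \<open>Differentiation under the integral. On \<open>Re w \<ge> d > 0\<close> the derivative of
  the exponential is at most \<open>s * exp (- (d * s)) \<le> 1 / d\<close>, which by the mean value
  bound dominates all difference quotients at once.\<close>

lemma holomorphic_laplace_transform:
  fixes g :: "real \<Rightarrow> real"
  assumes g: "integrable lborel g" and g0: "\<And>s. s \<le> 0 \<Longrightarrow> g s = 0"
  shows "(\<lambda>z. LBINT s. exp (- z * of_real s) * of_real (g s)) holomorphic_on {z. Re z > 0}"
proof -
  have [measurable]: "g \<in> borel_measurable borel" using g by auto
  define f where "f z = (LBINT s. exp (- z * of_real s) * complex_of_real (g s))" for z
  have exp_le: "norm (exp (- z * of_real s)) \<le> exp (- (d * s))" if "s > 0" "d \<le> Re z" for z s d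
    using that by simp
  have int: "integrable lborel (\<lambda>s. exp (- z * of_real s) * complex_of_real (g s))" if "Re z > 0" for z
  proof (rule Bochner_Integration.integrable_bound[OF g])
    show "AE s in lborel. norm (exp (- z * of_real s) * complex_of_real (g s)) \<le> norm (g s)"
    proof (intro AE_I2)
      fix s
      show "norm (exp (- z * of_real s) * complex_of_real (g s)) \<le> norm (g s)"
        using that g0[of s] by (cases "s > 0") (auto simp: norm_mult intro!: mult_left_le_one_le)
    qed
  qed measurable
  have "(f has_field_derivative (LBINT s. - of_real s * exp (- z * of_real s) * complex_of_real (g s))) (at z)"
    if z: "Re z > 0" for z
    unfolding has_field_derivative_iff tendsto_at_iff_sequentially o_def
  proof (intro allI impI)
    fix X assume X: "\<forall>i. X i \<in> UNIV - {z}" "X \<longlonglongrightarrow> z"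
    \<comment> \<open>Half the real part, so that \<open>z\<close> and all late terms of the
      sequence lie in the convex half plane \<open>d \<le> Re w\<close>; the shift by
      \<open>N\<close> below discards the early terms.\<close>
    define d where "d = Re z / 2"
    have d: "d > 0" using z by (simp add: d_def)
    have "(\<lambda>n. Re (X n)) \<longlonglongrightarrow> Re z" by (intro tendsto_intros X)
    hence "\<forall>\<^sub>F n in sequentially. Re (X n) > d" using z by (intro order_tendstoD(1)) (auto simp: d_def)
    then obtain N where "\<And>n. n \<ge> N \<Longrightarrow> Re (X n) > d"
      by (auto simp: eventually_sequentially)
    hence N: "Re (X (n + N)) \<ge> d" for n by (simp add: less_imp_le)
    have "(\<lambda>n. (f (X (n + N)) - f z) / (X (n + N) - z)) \<longlonglongrightarrow>
        (LBINT s. - of_real s * exp (- z * of_real s) * complex_of_real (g s))"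
    proof -
      have eq: "(f (X (n + N)) - f z) / (X (n + N) - z) =
          (LBINT s. (exp (- X (n + N) * of_real s) - exp (- z * of_real s)) / (X (n + N) - z) * of_real (g s))" for n
      proof -
        have "f (X (n + N)) - f z = (LBINT s. exp (- X (n + N) * of_real s) * of_real (g s) - exp (- z * of_real s) * of_real (g s))"
          unfolding f_def using N[of n] d z by (intro Bochner_Integration.integral_diff[symmetric] int) auto
        thus ?thesis
          by (simp only: integral_divide_zero[symmetric] left_diff_distrib[symmetric] times_divide_eq_left)
      qed
      show ?thesis unfolding eq
      proof (rule integral_dominated_convergence[where w = "\<lambda>s. 1 / d * \<bar>g s\<bar>"])
        show "integrable lborel (\<lambda>s. 1 / d * \<bar>g s\<bar>)" using g by (intro integrable_mult_right integrable_abs)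
        show "AE s in lborel. norm ((exp (- X (n + N) * of_real s) - exp (- z * of_real s)) / (X (n + N) - z) * of_real (g s)) \<le> 1 / d * \<bar>g s\<bar>" for n
        proof (intro AE_I2)
          fix s
          show "norm ((exp (- X (n + N) * of_real s) - exp (- z * of_real s)) / (X (n + N) - z) * of_real (g s)) \<le> 1 / d * \<bar>g s\<bar>"
          proof (cases "s > 0")
            case True
            have "norm (exp (- X (n + N) * of_real s) - exp (- z * of_real s)) \<le> 1 / d * norm (X (n + N) - z)"
            proof (rule field_differentiable_bound[where S = "{w. d \<le> Re w}" and f' = "\<lambda>w. - of_real s * exp (- w * of_real s)"])
              show "convex {w. d \<le> Re w}" by (rule convex_halfspace_Re_ge)
              show "((\<lambda>w. exp (- w * of_real s)) has_field_derivative - of_real s * exp (- w * of_real s)) (at w within {w. d \<le> Re w})" for w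
                by (auto intro!: derivative_eq_intros)
              fix w assume "w \<in> {w. d \<le> Re w}"
              hence "norm (- of_real s * exp (- w * of_real s)) \<le> s * exp (- (d * s))"
                using exp_le[of s d w] True by (simp add: norm_mult)
              also have "d * s \<le> exp (d * s)" using exp_ge_add_one_self[of "d * s"] by linarith
              hence "s * exp (- (d * s)) \<le> 1 / d" using d by (simp add: exp_minus field_simps)
              finally show "norm (- of_real s * exp (- w * of_real s)) \<le> 1 / d" .
            qed (use N[of n] d d_def z in auto)
            hence "norm ((exp (- X (n + N) * of_real s) - exp (- z * of_real s)) / (X (n + N) - z)) \<le> 1 / d"
              using X(1) by (simp add: norm_divide divide_le_eq)
            thus ?thesis unfolding norm_mult norm_of_real by (intro mult_right_mono) auto
          qed (use g0[of s] in simp)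
        qed
        show "AE s in lborel. (\<lambda>n. (exp (- X (n + N) * of_real s) - exp (- z * of_real s)) / (X (n + N) - z) * of_real (g s))
            \<longlonglongrightarrow> - of_real s * exp (- z * of_real s) * complex_of_real (g s)"
        proof (intro AE_I2 tendsto_mult tendsto_const)
          fix s
          have "((\<lambda>w. exp (- w * of_real s)) has_field_derivative - of_real s * exp (- z * of_real s)) (at z)"
            by (auto intro!: derivative_eq_intros)
          hence "((\<lambda>w. (exp (- w * of_real s) - exp (- z * of_real s)) / (w - z)) \<longlongrightarrow> - of_real s * exp (- z * of_real s)) (at z)"
            by (simp add: has_field_derivative_iff)
          hence "(\<lambda>n. (exp (- X n * of_real s) - exp (- z * of_real s)) / (X n - z)) \<longlonglongrightarrow> - of_real s * exp (- z * of_real s)"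
            unfolding tendsto_at_iff_sequentially o_def using X by blast
          thus "(\<lambda>n. (exp (- X (n + N) * of_real s) - exp (- z * of_real s)) / (X (n + N) - z)) \<longlonglongrightarrow> - of_real s * exp (- z * of_real s)"
            by (rule LIMSEQ_ignore_initial_segment)
        qed
      qed measurable
    qed
    thus "(\<lambda>n. (f (X n) - f z) / (X n - z)) \<longlonglongrightarrow> (LBINT s. - of_real s * exp (- z * of_real s) * complex_of_real (g s))"
      by (rule LIMSEQ_offset)
  qed
  thus ?thesis
    unfolding f_def[symmetric, abs_def] holomorphic_on_def field_differentiable_def
    by (auto intro: has_field_derivative_at_within)
qed

text \<open>The identity theorem extends the formula from the positive axis to the open half plane,
  and dominated convergence, with majorant \<open>g\<close>, extends it to the boundary. The
  boundary is what matters first: the dispersive symbol has its exponent on the imaginary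
  axis.\<close>

lemma complex_laplace_transform_stable_density:
  assumes g: "stable_density \<alpha> r g" and z: "Re z \<ge> 0"
  shows "(LBINT s. exp (- z * of_real s) * of_real (g s)) = exp (- of_real r * z powr of_real \<alpha>)"
proof -
  have gi: "integrable lborel g" and g0: "\<And>s. s \<le> 0 \<Longrightarrow> g s = 0" and gnn: "\<And>s. g s \<ge> 0"
    and gl: "\<And>l. l \<ge> 0 \<Longrightarrow> (LBINT s. exp (- l * s) * g s) = exp (- r * l powr \<alpha>)"
    using g by (auto simp: stable_density_def)
  have [measurable]: "g \<in> borel_measurable borel" using gi by auto
  define f where "f z = (LBINT s. exp (- z * of_real s) * complex_of_real (g s))" for z
  have real: "f (of_real l) = exp (- of_real r * of_real l powr of_real \<alpha>)" if "l \<ge> 0" for l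
  proof -
    have "f (of_real l) = (LBINT s. of_real (exp (- l * s) * g s))"
      unfolding f_def by (intro Bochner_Integration.integral_cong) (auto simp: exp_of_real[symmetric])
    also have "\<dots> = of_real (exp (- r * l powr \<alpha>))" by (simp only: integral_complex_of_real gl[OF that])
    also have "\<dots> = exp (- of_real r * of_real l powr of_real \<alpha>)"
      using that by (simp add: powr_of_real exp_of_real[symmetric])
    finally show ?thesis .
  qed
  have half: "f w = exp (- of_real r * w powr of_real \<alpha>)" if "Re w > 0" for w
  proof -
    have "f w - exp (- of_real r * w powr of_real \<alpha>) = 0"
    proof (rule analytic_continuation[where f = "\<lambda>w. f w - exp (- of_real r * w powr of_real \<alpha>)"
          and S = "{z. Re z > 0}" and U = "of_real ` {0<..}" and \<xi> = 1])
      show "(\<lambda>w. f w - exp (- of_real r * w powr of_real \<alpha>)) holomorphic_on {z. Re z > 0}"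
        unfolding f_def
        by (intro holomorphic_on_diff holomorphic_laplace_transform gi g0 holomorphic_intros)
           (auto simp: complex_nonpos_Reals_iff)
      show "open {z. Re z > 0}" by (rule open_halfspace_Re_gt)
      show "connected {z. Re z > 0}" by (intro convex_connected convex_halfspace_Re_gt)
      show "(1::complex) islimpt of_real ` {0<..}"
        unfolding islimpt_sequential
      proof (intro exI conjI allI)
        have "(\<lambda>k. 1 + 1 / (real k + 1)) \<longlonglongrightarrow> 1" by real_asymp
        from tendsto_of_real[OF this] show "(\<lambda>k. complex_of_real (1 + 1 / (real k + 1))) \<longlonglongrightarrow> 1"
          by (simp only: of_real_1)
        show "complex_of_real (1 + 1 / (real k + 1)) \<in> of_real ` {0<..} - {1}" for k
          by (auto simp del: of_real_add of_real_divide intro!: imageI add_pos_nonneg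
              simp: of_real_eq_1_iff)
      qed
      show "f w - exp (- of_real r * w powr of_real \<alpha>) = 0" if "w \<in> of_real ` {0<..}" for w
        using that real by auto
    qed (use that in auto)
    thus ?thesis by simp
  qed
  show ?thesis
  \<comment> \<open>The origin lies on the branch cut of \<open>powr\<close>, so the limit argument
    excludes it; there the real formula suffices.\<close>
  proof (cases "z = 0")
    case True
    thus ?thesis using real[of 0] by (simp add: f_def)
  next
    case False
    define w where "w k = z + of_real (1 / (real k + 1))" for k
    have w: "w \<longlonglongrightarrow> z"
    proof -
      have "(\<lambda>k. 1 / (real k + 1)) \<longlonglongrightarrow> 0" by real_asymp
      from tendsto_add[OF tendsto_const[of z] tendsto_of_real[OF this]] show ?thesis unfolding w_def by simp
    qed
    have Re_w: "Re (w k) > 0" for k using z by (simp add: w_def add_nonneg_pos)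
    have "(\<lambda>k. f (w k)) \<longlonglongrightarrow> f z"
      unfolding f_def
    proof (rule integral_dominated_convergence[OF _ _ gi])
      show "AE s in lborel. (\<lambda>k. exp (- w k * of_real s) * complex_of_real (g s)) \<longlonglongrightarrow> exp (- z * of_real s) * of_real (g s)"
        by (intro AE_I2 tendsto_intros w)
      show "AE s in lborel. norm (exp (- w k * of_real s) * complex_of_real (g s)) \<le> g s" for k
      proof (intro AE_I2)
        fix s show "norm (exp (- w k * of_real s) * complex_of_real (g s)) \<le> g s"
          using Re_w[of k] g0[of s] gnn[of s] 
          by (cases "s > 0") (auto simp: norm_mult intro!: mult_left_le_one_le)
      qed
    qed measurable
    moreover have "(\<lambda>k. f (w k)) \<longlonglongrightarrow> exp (- of_real r * z powr of_real \<alpha>)"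
      unfolding half[OF Re_w]
    proof (rule isCont_tendsto_compose[OF _ w])
      have "z \<notin> \<real>\<^sub>\<le>\<^sub>0"
        using False z by (auto simp: complex_nonpos_Reals_iff complex_eq_iff)
      thus "isCont (\<lambda>z. exp (- of_real r * z powr of_real \<alpha>)) z"
        by (intro continuous_intros continuous_powr_complex) auto
    qed
    ultimately have "f z = exp (- of_real r * z powr of_real \<alpha>)" by (rule LIMSEQ_unique)
    thus ?thesis by (simp add: f_def)
  qed
qed

text \<open>Write s^(-1/N) as the length of the interval of y > 0 with y^N s at most 1. On it
  \<open>1 \<le> exp 1 * exp (- (y ^ N) * s)\<close>, which explains the factor
  \<open>exp 1\<close>. Tonelli and the Laplace transform at \<open>y ^ N\<close> then leave the
  integral of \<open>exp (- r * y)\<close>, which is finite.\<close>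

lemma integrable_stable_density_negative_moment:
  assumes g: "stable_density (1 / real N) r g" and r: "r > 0" and N: "N > 0"
  shows "integrable lborel (\<lambda>s. s powr (- (1 / real N)) * g s)"
proof -
  have gi: "integrable lborel g" and g0: "\<And>s. s \<le> 0 \<Longrightarrow> g s = 0" and gnn: "\<And>s. g s \<ge> 0"
    and gl: "\<And>l. l \<ge> 0 \<Longrightarrow> (LBINT s. exp (- l * s) * g s) = exp (- r * l powr (1 / real N))"
    using g by (auto simp: stable_density_def)
  have [measurable]: "g \<in> borel_measurable borel" using gi by auto
  define \<alpha> where "\<alpha> = 1 / real N"
  have le: "ennreal (s powr (-\<alpha>) * g s) \<le>
      (\<integral>\<^sup>+y. ennreal (exp 1 * g s * (indicator {0<..} y * exp (- (y ^ N) * s))) \<partial>lborel)" for s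
  proof (cases "s > 0")
    case True
    have "ennreal (s powr (-\<alpha>) * g s) = (\<integral>\<^sup>+y. ennreal (g s) * indicator {0<..s powr (-\<alpha>)} y \<partial>lborel)"
      by (subst nn_integral_cmult_indicator) (auto simp: ennreal_mult' gnn mult.commute)
    also have "\<dots> \<le> (\<integral>\<^sup>+y. ennreal (exp 1 * g s * (indicator {0<..} y * exp (- (y ^ N) * s))) \<partial>lborel)"
    proof (intro nn_integral_mono)
      fix y :: real
      show "ennreal (g s) * indicator {0<..s powr (-\<alpha>)} y \<le> ennreal (exp 1 * g s * (indicator {0<..} y * exp (- (y ^ N) * s)))"
      proof (cases "y \<in> {0<..s powr (-\<alpha>)}")
        case y: True
        hence "y ^ N \<le> (s powr (-\<alpha>)) ^ N" by (intro power_mono) auto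
        also have "(s powr (-\<alpha>)) ^ N = (s powr (-\<alpha>)) powr real N" using True by (simp add: powr_realpow)
        also have "\<dots> = s powr (-1)" unfolding powr_powr \<alpha>_def using N by simp
        also have "\<dots> = 1 / s" using True by (simp add: powr_minus divide_inverse)
        finally have "y ^ N * s \<le> 1" using True by (simp add: field_simps)
        hence "1 \<le> exp (1 - y ^ N * s)" by simp
        also have "\<dots> = exp 1 * exp (- (y ^ N) * s)" by (simp flip: exp_add)
        finally have "g s * 1 \<le> g s * (exp 1 * exp (- (y ^ N) * s))" by (intro mult_left_mono gnn)
        thus ?thesis using y by (simp add: mult_ac ennreal_leI)
      qed simp
    qed
    finally show ?thesis .
  qed (use g0[of s] in simp)
  have "(\<integral>\<^sup>+s. ennreal (norm (s powr (-\<alpha>) * g s)) \<partial>lborel) \<le>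
      (\<integral>\<^sup>+s. \<integral>\<^sup>+y. ennreal (exp 1 * g s * (indicator {0<..} y * exp (- (y ^ N) * s))) \<partial>lborel \<partial>lborel)"
    using le by (intro nn_integral_mono) (simp add: gnn)
  also have "\<dots> = (\<integral>\<^sup>+y. \<integral>\<^sup>+s. ennreal (exp 1 * g s * (indicator {0<..} y * exp (- (y ^ N) * s))) \<partial>lborel \<partial>lborel)"
    by (rule lborel_pair.Fubini') measurable
  also have "\<dots> = (\<integral>\<^sup>+y. ennreal (exp 1 * (indicator {0<..} y * exp (- r * y))) \<partial>lborel)"
  proof (intro nn_integral_cong)
    fix y :: real
    show "(\<integral>\<^sup>+s. ennreal (exp 1 * g s * (indicator {0<..} y * exp (- (y ^ N) * s))) \<partial>lborel) =
        ennreal (exp 1 * (indicator {0<..} y * exp (- r * y)))"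
    proof (cases "y > 0")
      case True
      have i: "integrable lborel (\<lambda>s. exp (- (y ^ N) * s) * g s)"
      proof (rule Bochner_Integration.integrable_bound[OF gi])
        show "AE s in lborel. norm (exp (- (y ^ N) * s) * g s) \<le> norm (g s)"
        proof (intro AE_I2)
          fix s show "norm (exp (- (y ^ N) * s) * g s) \<le> norm (g s)"
            using g0[of s] gnn[of s] True by (cases "s > 0") (auto simp: abs_mult intro!: mult_left_le_one_le)
        qed
      qed measurable
      have "(\<integral>\<^sup>+s. ennreal (exp 1 * g s * (indicator {0<..} y * exp (- (y ^ N) * s))) \<partial>lborel)
         = (\<integral>\<^sup>+s. ennreal (exp 1 * (exp (- (y ^ N) * s) * g s)) \<partial>lborel)"
        using True by (intro nn_integral_cong) (simp add: mult_ac)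
      also have "\<dots> = ennreal (LBINT s. exp 1 * (exp (- (y ^ N) * s) * g s))"
        using i gnn by (intro nn_integral_eq_integral integrable_mult_right) auto
      also have "(LBINT s. exp 1 * (exp (- (y ^ N) * s) * g s)) = exp 1 * exp (- r * (y ^ N) powr (1 / real N))"
        using gl[of "y ^ N"] True by simp
      also have "(y ^ N) powr (1 / real N) = y"
        using True N by (simp add: powr_realpow[symmetric] powr_powr)
      finally show ?thesis using True by simp
    qed simp
  qed
  also have "\<dots> < \<infinity>"
  proof -
    have "integrable lborel (\<lambda>y. norm (indicator {0..} y *\<^sub>R exp (- of_real r * complex_of_real y)))"
      using has_bochner_integral_exp_half_line[of "of_real r"] r by (intro integrable_norm) (simp add: has_bochner_integral_iff)
    hence "integrable lborel (\<lambda>y. exp 1 * norm (indicator {0..} y *\<^sub>R exp (- of_real r * complex_of_real y)))"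
      by (rule integrable_mult_right)
    hence "(\<integral>\<^sup>+y. ennreal (norm (exp 1 * norm (indicator {0..} y *\<^sub>R exp (- of_real r * complex_of_real y)))) \<partial>lborel) < \<infinity>"
      unfolding integrable_iff_bounded by simp
    moreover have "(\<integral>\<^sup>+y. ennreal (exp 1 * (indicator {0<..} y * exp (- r * y))) \<partial>lborel)
      \<le> (\<integral>\<^sup>+y. ennreal (norm (exp 1 * norm (indicator {0..} y *\<^sub>R exp (- of_real r * complex_of_real y)))) \<partial>lborel)"
      by (intro nn_integral_mono ennreal_leI) (auto simp: indicator_def abs_mult)
    ultimately show ?thesis by (rule le_less_trans[rotated])
  qed
  finally show ?thesis unfolding \<alpha>_def by (intro integrableI_bounded) measurable
qed

section \<open>Stable characteristic functions\<close>

text \<open>Polar form, because a power with exponent \<open>\<alpha>\<close> then multiplies both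
  \<open>\<nu>\<close> and \<open>\<theta>\<close> by \<open>\<alpha>\<close>. The factor
  \<open>sgn b\<close> makes the values at \<open>b\<close> and \<open>- b\<close> conjugate, as a
  real density requires.\<close>

definition stable_exponent :: "real \<Rightarrow> real \<Rightarrow> real \<Rightarrow> complex" where
  "stable_exponent \<nu> \<theta> b = of_real (\<bar>b\<bar> powr \<nu>) * cis (sgn b * \<theta>)"

lemma stable_exponent_0 [simp]: "stable_exponent \<nu> \<theta> 0 = 0"
  by (simp add: stable_exponent_def)

lemma Re_stable_exponent: "Re (stable_exponent \<nu> \<theta> b) = \<bar>b\<bar> powr \<nu> * cos \<theta>"
  by (cases "b = 0") (auto simp: stable_exponent_def sgn_if)

lemma stable_exponent_dilate:
  "a > 0 \<Longrightarrow> stable_exponent \<nu> \<theta> (a * b) = of_real (a powr \<nu>) * stable_exponent \<nu> \<theta> b"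
  by (simp add: stable_exponent_def abs_mult powr_mult sgn_mult)

text \<open>An angle below \<open>pi\<close> stays on the principal branch of the logarithm, so the
  complex power acts on modulus and angle separately.\<close>

lemma stable_exponent_powr:
  assumes "0 \<le> \<theta>" "\<theta> < pi"
  shows "stable_exponent \<nu> \<theta> b powr of_real \<alpha> = stable_exponent (\<nu> * \<alpha>) (\<theta> * \<alpha>) b"
proof (cases "b = 0")
  case False
  have "\<bar>sgn b * \<theta>\<bar> < pi" using assms by (simp add: abs_mult sgn_if)
  hence L: "Ln (cis (sgn b * \<theta>)) = \<i> * of_real (sgn b * \<theta>)"
    unfolding cis_conv_exp by (intro Ln_exp) (auto simp: abs_less_iff)
  have "Ln (stable_exponent \<nu> \<theta> b) = of_real (\<nu> * ln \<bar>b\<bar>) + \<i> * of_real (sgn b * \<theta>)"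
    unfolding stable_exponent_def using False by (subst Ln_times_of_real) (simp_all add: L ln_powr Ln_of_real)
  moreover have "stable_exponent \<nu> \<theta> b \<noteq> 0" using False by (simp add: stable_exponent_def)
  ultimately have "stable_exponent \<nu> \<theta> b powr of_real \<alpha> =
      exp (of_real (\<alpha> * \<nu> * ln \<bar>b\<bar>) + \<i> * of_real (sgn b * (\<theta> * \<alpha>)))"
    by (simp add: powr_def ring_distribs mult_ac)
  also have "\<dots> = stable_exponent (\<nu> * \<alpha>) (\<theta> * \<alpha>) b"
    unfolding stable_exponent_def exp_add cis_conv_exp exp_of_real
    using False by (simp add: powr_def mult_ac)
  finally show ?thesis .
qed simp

lemma continuous_stable_exponent:
  assumes "\<nu> > 0"
  shows "continuous_on UNIV (stable_exponent \<nu> \<theta>)"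
proof (rule continuous_at_imp_continuous_on, intro ballI)
  fix b :: real
  show "isCont (stable_exponent \<nu> \<theta>) b"
  proof (cases "b = 0")
    case True
    have "(stable_exponent \<nu> \<theta> \<longlongrightarrow> 0) (at 0)"
    proof (rule Lim_null_comparison)
      have "continuous_on UNIV (\<lambda>b::real. \<bar>b\<bar> powr \<nu>)"
        using assms by (intro continuous_on_powr' continuous_intros) auto
      hence "isCont (\<lambda>b::real. \<bar>b\<bar> powr \<nu>) 0" by (simp add: continuous_on_eq_continuous_at)
      thus "((\<lambda>b::real. \<bar>b\<bar> powr \<nu>) \<longlongrightarrow> 0) (at 0)" by (simp add: isCont_def)
    qed (simp add: stable_exponent_def norm_mult)
    thus ?thesis using True by (simp add: isCont_def)
  next
    case False
    have "isCont (\<lambda>x. of_real (\<bar>x\<bar> powr \<nu>) * cis (sgn b * \<theta>)) b"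
      using False by (intro continuous_intros) auto
    moreover have "\<forall>\<^sub>F x in nhds b. x \<in> (if b > 0 then {0<..} else {..<0})"
      using False by (intro eventually_nhds_in_open) auto
    hence "\<forall>\<^sub>F x in nhds b. of_real (\<bar>x\<bar> powr \<nu>) * cis (sgn b * \<theta>) = stable_exponent \<nu> \<theta> x"
      by eventually_elim (use False in \<open>auto simp: stable_exponent_def split: if_splits\<close>)
    ultimately show ?thesis by (simp add: isCont_cong)
  qed
qed

text \<open>The product with 1 + b^2 is continuous and tends to 0, hence is bounded, which gives a
  Cauchy type majorant for every positive \<open>\<nu>\<close>, however small.\<close>

lemma integrable_exp_minus_abs_powr:
  fixes c \<nu> :: real
  assumes "c > 0" "\<nu> > 0"
  shows "integrable lborel (\<lambda>b. exp (- c * \<bar>b\<bar> powr \<nu>))"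
proof -
  define f where "f b = (1 + b\<^sup>2) * exp (- c * \<bar>b\<bar> powr \<nu>)" for b :: real
  have "((\<lambda>b. (1 + b\<^sup>2) * exp (- c * b powr \<nu>)) \<longlongrightarrow> 0) at_top"
    using assms by real_asymp
  moreover have "\<forall>\<^sub>F b in at_top. (1 + b\<^sup>2) * exp (- c * b powr \<nu>) = f b"
    using eventually_ge_at_top[of 0] by eventually_elim (simp add: f_def)
  ultimately have lim: "(f \<longlongrightarrow> 0) at_top" by (rule Lim_transform_eventually)
  have "continuous_on {0..} f" unfolding f_def
    using assms by (intro continuous_intros continuous_on_powr') auto
  then obtain M where M: "M > 0" "\<And>b. b \<ge> 0 \<Longrightarrow> norm (f b) \<le> M"
    using bounded_if_convergent_at_top[OF _ lim] by blast
  show ?thesis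
  proof (rule Bochner_Integration.integrable_bound)
    show "integrable lborel (\<lambda>b::real. M / (1 + b\<^sup>2))"
      using integrable_inverse_1_plus_square_scaled[of 1 M] by simp
    show "AE b in lborel. norm (exp (- c * \<bar>b\<bar> powr \<nu>)) \<le> norm (M / (1 + b\<^sup>2))"
    proof (intro AE_I2)
      fix b :: real
      have "1 + b\<^sup>2 > 0" by (simp add: add_pos_nonneg)
      moreover have "(1 + b\<^sup>2) * exp (- c * \<bar>b\<bar> powr \<nu>) \<le> M"
        using M(2)[of "\<bar>b\<bar>"] by (simp add: f_def abs_mult)
      ultimately show "norm (exp (- c * \<bar>b\<bar> powr \<nu>)) \<le> norm (M / (1 + b\<^sup>2))"
        using M(1) by (simp add: pos_le_divide_eq mult.commute)
    qed
  qed measurable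
qed

section \<open>Stable characteristic functions and their inversion\<close>

definition stable_char :: "real \<Rightarrow> real \<Rightarrow> real \<Rightarrow> real \<Rightarrow> complex" where
  "stable_char \<nu> \<theta> r b = exp (- of_real r * stable_exponent \<nu> \<theta> b)"

lemma norm_stable_char: "norm (stable_char \<nu> \<theta> r b) = exp (- (r * cos \<theta>) * \<bar>b\<bar> powr \<nu>)"
  by (simp add: stable_char_def Re_stable_exponent mult_ac)

lemma norm_stable_char_le_1:
  assumes "r \<ge> 0" "cos \<theta> \<ge> 0"
  shows "norm (stable_char \<nu> \<theta> r b) \<le> 1"
  using assms by (simp add: norm_stable_char)

lemma continuous_stable_char: "\<nu> > 0 \<Longrightarrow> continuous_on UNIV (stable_char \<nu> \<theta> r)"
  unfolding stable_char_def[abs_def] by (intro continuous_intros continuous_stable_exponent)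

lemma integrable_stable_char:
  assumes "\<nu> > 0" "r > 0" "cos \<theta> > 0"
  shows "integrable lborel (stable_char \<nu> \<theta> r)"
proof (rule Bochner_Integration.integrable_bound)
  show "integrable lborel (\<lambda>b. exp (- (r * cos \<theta>) * \<bar>b\<bar> powr \<nu>))"
    using assms by (intro integrable_exp_minus_abs_powr) auto
  show "stable_char \<nu> \<theta> r \<in> borel_measurable lborel"
    using borel_measurable_continuous_onI[OF continuous_stable_char[OF assms(1)]] by simp
qed (auto simp: norm_stable_char)

text \<open>The Gaussian-weighted integrals of \<open>p\<close> are Gaussian means of
  \<open>\<phi>\<close> around 0 and hence at most \<open>C\<close>. For nonnegative
  \<open>p\<close> Fatou's lemma turns this into integrability, after which dominated convergence
  recovers \<open>\<phi>\<close>.\<close>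

lemma fourier_inversion_nonneg:
  fixes \<phi> :: "real \<Rightarrow> complex" and p :: "real \<Rightarrow> real"
  assumes \<phi>i: "integrable lborel \<phi>" and \<phi>: "continuous_on UNIV \<phi>" and \<phi>b: "\<And>b. norm (\<phi> b) \<le> C"
    and p: "\<And>x. of_real (2 * pi * p x) = (LBINT b. iexp (- (b * x)) * \<phi> b)" and p0: "\<And>x. p x \<ge> 0"
  shows "continuous_on UNIV p" "\<And>x. \<bar>p x\<bar> \<le> (LBINT b. norm (\<phi> b)) / (2 * pi)"
    "\<And>b. has_bochner_integral lborel (\<lambda>x. iexp (b * x) * of_real (p x)) (\<phi> b)"
proof -
  have [measurable]: "\<phi> \<in> borel_measurable borel" using \<phi>i by auto
  define P where "P x = (LBINT b. iexp (- (b * x)) * \<phi> b)" for x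
  have "isCont P x" for x
    unfolding isCont_def tendsto_at_iff_sequentially o_def P_def
  proof (intro allI impI)
    fix X assume X: "\<forall>i. X i \<in> UNIV - {x}" "X \<longlonglongrightarrow> x"
    show "(\<lambda>n. LBINT b. iexp (- (b * X n)) * \<phi> b) \<longlonglongrightarrow> (LBINT b. iexp (- (b * x)) * \<phi> b)"
      by (rule integral_dominated_convergence[OF _ _ integrable_norm[OF \<phi>i]])
         (auto intro!: tendsto_intros X AE_I2 simp: norm_mult simp del: of_real_mult of_real_minus)
  qed
  hence "continuous_on UNIV (\<lambda>x. Re (P x) / (2 * pi))"
    by (intro continuous_intros continuous_at_imp_continuous_on ballI) auto
  also have "(\<lambda>x. Re (P x) / (2 * pi)) = p" unfolding P_def p[symmetric] by simp
  finally show pc: "continuous_on UNIV p" .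
  show pb: "\<bar>p x\<bar> \<le> (LBINT b. norm (\<phi> b)) / (2 * pi)" for x
  proof -
    have "norm (complex_of_real (2 * pi * p x)) \<le> (LBINT b. norm (iexp (- (b * x)) * \<phi> b))"
      unfolding p by (rule integral_norm_bound)
    also have "\<dots> = (LBINT b. norm (\<phi> b))" unfolding norm_mult norm_exp_i_times by simp
    finally have "2 * pi * \<bar>p x\<bar> \<le> (LBINT b. norm (\<phi> b))" unfolding norm_of_real by (simp add: abs_mult)
    thus ?thesis by (simp add: pos_le_divide_eq mult_ac)
  qed
  have [measurable]: "p \<in> borel_measurable borel" by (rule borel_measurable_continuous_onI[OF pc])
  have p_minus: "of_real (2 * pi * p (- x)) = (LBINT y. iexp (x * y) * \<phi> y)" for x
    using p[of "- x"] by (simp only: mult_minus_right minus_minus mult.commute[of x])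
  \<comment> \<open>The two sides of the transform change places: \<open>2 * pi * p (- x)\<close> is
    the Fourier transform of the integrable \<open>\<phi>\<close>, so the Gaussian inversion formula
    is used for \<open>\<phi>\<close>.\<close>
  have mean: "(LBINT x. iexp (b * x) * of_real (exp (- (\<sigma> * x)\<^sup>2 / 2) * p x)) =
      (LBINT z. of_real (std_normal_density z) * \<phi> (b + \<sigma> * z))" if "\<sigma> > 0" for b \<sigma>
  proof -
    have "(LBINT x. iexp (b * x) * of_real (exp (- (\<sigma> * x)\<^sup>2 / 2) * p x)) = 
       (LBINT x. iexp (- (x * b)) * of_real (exp (- (\<sigma> * x)\<^sup>2 / 2) * p (- x)))"
      by (subst lborel_integral_real_affine[of "-1" _ 0]) (simp_all add: mult.commute)
    hence "of_real (2 * pi) * (LBINT x. iexp (b * x) * of_real (exp (- (\<sigma> * x)\<^sup>2 / 2) * p x)) =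
        of_real (2 * pi) * (LBINT x. iexp (- (x * b)) * of_real (exp (- (\<sigma> * x)\<^sup>2 / 2) * p (- x)))" by simp
    also have "\<dots> = (LBINT x. iexp (- (x * b)) * of_real (exp (- (\<sigma> * x)\<^sup>2 / 2)) * of_real (2 * pi * p (- x)))"
      unfolding integral_mult_right_zero[symmetric]
      by (intro Bochner_Integration.integral_cong refl) (simp only: of_real_mult mult_ac)
    also have "\<dots> = (LBINT x. iexp (- (x * b)) * of_real (exp (- (\<sigma> * x)\<^sup>2 / 2)) * (LBINT y. iexp (x * y) * \<phi> y))"
      unfolding p_minus ..
    also have "\<dots> = of_real (2 * pi) * (LBINT z. of_real (std_normal_density z) * \<phi> (b + \<sigma> * z))"
      by (rule fourier_gaussian_mean[OF \<phi>i that])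
    finally show ?thesis by simp
  qed
  define \<sigma> :: "nat \<Rightarrow> real" where "\<sigma> k = 1 / (real k + 1)" for k
  have \<sigma>: "\<sigma> k > 0" for k by (simp add: \<sigma>_def)
  have \<sigma>0: "\<sigma> \<longlonglongrightarrow> 0" unfolding \<sigma>_def by real_asymp
  have e_lim: "(\<lambda>k. exp (- (\<sigma> k * x)\<^sup>2 / 2)) \<longlonglongrightarrow> 1" for x
  proof -
    have "(\<lambda>k. exp (- (\<sigma> k * x)\<^sup>2 / 2)) \<longlonglongrightarrow> exp (- (0 * x)\<^sup>2 / 2)" by (intro tendsto_intros \<sigma>0) simp
    thus ?thesis by simp
  qed
  have pi: "integrable lborel p"
  proof (rule integrableI_bounded)
    have bound: "(\<integral>\<^sup>+x. ennreal (exp (- (\<sigma> k * x)\<^sup>2 / 2) * p x) \<partial>lborel) \<le> ennreal C" for k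
    proof -
      define M where "M = (LBINT b. norm (\<phi> b)) / (2 * pi)"
      have g: "integrable lborel (\<lambda>x. exp (- (\<sigma> k * x)\<^sup>2 / 2))"
        using integrable_norm[OF has_bochner_integral_gaussian_fourier[OF \<sigma>[of k], of 0, THEN integrable.intros]]
        by (simp del: of_real_exp)
      have i: "integrable lborel (\<lambda>x. exp (- (\<sigma> k * x)\<^sup>2 / 2) * p x)"
      proof (rule Bochner_Integration.integrable_bound[OF integrable_mult_right[OF g, of M]])
        show "AE x in lborel. norm (exp (- (\<sigma> k * x)\<^sup>2 / 2) * p x) \<le> norm (M * exp (- (\<sigma> k * x)\<^sup>2 / 2))"
        proof (intro AE_I2)
          fix x
          have "\<bar>p x\<bar> \<le> \<bar>M\<bar>" using pb[of x] unfolding M_def by linarith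
          thus "norm (exp (- (\<sigma> k * x)\<^sup>2 / 2) * p x) \<le> norm (M * exp (- (\<sigma> k * x)\<^sup>2 / 2))"
            by (simp add: abs_mult mult.commute mult_right_mono)
        qed
      qed measurable
      have "norm (LBINT x. iexp (0 * x) * of_real (exp (- (\<sigma> k * x)\<^sup>2 / 2) * p x)) \<le> C"
        unfolding mean[OF \<sigma>] by (intro norm_gaussian_mean_le \<phi>b) measurable
      also have "(LBINT x. iexp (0 * x) * of_real (exp (- (\<sigma> k * x)\<^sup>2 / 2) * p x)) =
          of_real (LBINT x. exp (- (\<sigma> k * x)\<^sup>2 / 2) * p x)"
        unfolding integral_complex_of_real[symmetric] by simp
      finally have "(LBINT x. exp (- (\<sigma> k * x)\<^sup>2 / 2) * p x) \<le> C" by simp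
      thus ?thesis using i p0 by (subst nn_integral_eq_integral) (auto intro: ennreal_leI)
    qed
    have "(\<integral>\<^sup>+x. ennreal (norm (p x)) \<partial>lborel) = (\<integral>\<^sup>+x. liminf (\<lambda>k. ennreal (exp (- (\<sigma> k * x)\<^sup>2 / 2) * p x)) \<partial>lborel)"
    proof (intro nn_integral_cong)
      fix x
      have "(\<lambda>k. ennreal (exp (- (\<sigma> k * x)\<^sup>2 / 2) * p x)) \<longlonglongrightarrow> ennreal (1 * p x)"
        by (intro tendsto_ennrealI tendsto_mult e_lim tendsto_const)
      hence "liminf (\<lambda>k. ennreal (exp (- (\<sigma> k * x)\<^sup>2 / 2) * p x)) = ennreal (1 * p x)"
        by (intro lim_imp_Liminf) auto
      thus "ennreal (norm (p x)) = liminf (\<lambda>k. ennreal (exp (- (\<sigma> k * x)\<^sup>2 / 2) * p x))"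
        using p0 by simp
    qed
    also have "\<dots> \<le> liminf (\<lambda>k. \<integral>\<^sup>+x. ennreal (exp (- (\<sigma> k * x)\<^sup>2 / 2) * p x) \<partial>lborel)"
      by (rule nn_integral_liminf) measurable
    also have "\<dots> \<le> liminf (\<lambda>k. ennreal C)" by (intro Liminf_mono always_eventually allI bound)
    also have "\<dots> = ennreal C" by (simp add: Liminf_const)
    finally show "(\<integral>\<^sup>+x. ennreal (norm (p x)) \<partial>lborel) < \<infinity>" by (rule le_less_trans) simp
  qed measurable
  fix b
  have i: "integrable lborel (\<lambda>x. iexp (b * x) * complex_of_real (p x))"
    by (rule Bochner_Integration.integrable_bound[OF pi]) (auto simp: norm_mult simp del: of_real_mult)
  have "(\<lambda>k. LBINT x. iexp (b * x) * of_real (exp (- (\<sigma> k * x)\<^sup>2 / 2) * p x)) \<longlonglongrightarrow>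
      (LBINT x. iexp (b * x) * of_real (1 * p x))"
  proof (rule integral_dominated_convergence[OF _ _ pi])
    show "AE x in lborel. (\<lambda>k. iexp (b * x) * of_real (exp (- (\<sigma> k * x)\<^sup>2 / 2) * p x)) \<longlonglongrightarrow> iexp (b * x) * of_real (1 * p x)"
      by (intro AE_I2 tendsto_mult tendsto_of_real e_lim tendsto_const)
    show "AE x in lborel. norm (iexp (b * x) * of_real (exp (- (\<sigma> k * x)\<^sup>2 / 2) * p x)) \<le> p x" for k
      unfolding norm_mult norm_exp_i_times norm_of_real using p0
      by (intro AE_I2) (auto simp: abs_mult intro!: mult_left_le_one_le)
  qed measurable
  moreover have "(\<lambda>k. LBINT x. iexp (b * x) * of_real (exp (- (\<sigma> k * x)\<^sup>2 / 2) * p x)) \<longlonglongrightarrow> \<phi> b"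
    unfolding mean[OF \<sigma>] by (rule gaussian_mean_tendsto[OF \<phi> \<phi>b \<sigma>0])
  ultimately have "(LBINT x. iexp (b * x) * of_real (1 * p x)) = \<phi> b" by (rule LIMSEQ_unique)
  thus "has_bochner_integral lborel (\<lambda>x. iexp (b * x) * of_real (p x)) (\<phi> b)"
    using i by (simp add: has_bochner_integral_iff)
qed

text \<open>For \<open>\<nu> = 1\<close> the integrand is an exponential on each half line, with
  conjugate rates \<open>z\<close> and \<open>cnj z\<close>, so the integral is twice the real part
  of \<open>1 / z\<close>. This \<open>p\<close> is the Cauchy density with scale
  \<open>r * cos \<theta>\<close> centred at \<open>- r * sin \<theta>\<close>, and it is positive
  because \<open>Re z > 0\<close>.\<close>

lemma cauchy_density_from_stable_char:
  assumes "r > 0" "cos \<theta> > 0"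
  defines "p \<equiv> (\<lambda>x. Re (1 / (of_real r * cis \<theta> + \<i> * of_real x)) / pi)"
  shows "p x \<ge> 0" "of_real (2 * pi * p x) = (LBINT b. iexp (- (b * x)) * stable_char 1 \<theta> r b)"
proof -
  define z where "z = of_real r * cis \<theta> + \<i> * of_real x"
  have z: "Re z > 0" using assms by (simp add: z_def)
  thus "p x \<ge> 0" unfolding p_def z_def[symmetric] by (simp add: Re_divide)
  have "(\<lambda>b. iexp (- (b * x)) * stable_char 1 \<theta> r b) =
      (\<lambda>b. if b \<ge> 0 then exp (- z * of_real b) else exp (cnj z * of_real b))"
  proof
    fix b :: real
    have "iexp (- (b * x)) * stable_char 1 \<theta> r b = exp (\<i> * of_real (- (b * x)) - of_real r * stable_exponent 1 \<theta> b)"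
      unfolding stable_char_def exp_add[symmetric] by simp
    also have "\<i> * of_real (- (b * x)) - of_real r * stable_exponent 1 \<theta> b =
        (if b \<ge> 0 then - z * of_real b else cnj z * of_real b)"
      by (cases "b = 0") (auto simp: stable_exponent_def z_def sgn_if cis_cnj[symmetric] complex_eq_iff algebra_simps)
    finally show "iexp (- (b * x)) * stable_char 1 \<theta> r b =
       (if b \<ge> 0 then exp (- z * of_real b) else exp (cnj z * of_real b))" by (simp split: if_splits)
  qed
  hence "(LBINT b. iexp (- (b * x)) * stable_char 1 \<theta> r b) = 1 / z + 1 / cnj z"
    using has_bochner_integral_exp_two_sided[of z "cnj z"] z by (simp add: has_bochner_integral_iff)
  also have "1 / z + 1 / cnj z = 1 / z + cnj (1 / z)" by simp
  also have "\<dots> = of_real (2 * Re (1 / z))" by (simp only: complex_add_cnj)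
  also have "2 * Re (1 / z) = 2 * pi * p x" unfolding p_def z_def[symmetric] by simp
  finally show "of_real (2 * pi * p x) = (LBINT b. iexp (- (b * x)) * stable_char 1 \<theta> r b)" by simp
qed

section \<open>Subordination\<close>

text \<open>The regularisation is two nested linear integrals of the symbol. With symbols bounded by
  1 and integrable \<open>g\<close>, Fubini carries the mixture through the Laplace smoothing and
  then through the Gaussian integral.\<close>

lemma mixture_gaussian_regularisation:
  fixes W :: "real \<Rightarrow> real \<Rightarrow> complex" and g :: "real \<Rightarrow> real"
  assumes W [measurable]: "case_prod W \<in> borel_measurable (lborel \<Otimes>\<^sub>M lborel)"
    and Wb: "\<And>s b. norm (W s b) \<le> 1" and g: "integrable lborel g"
    and \<phi>: "\<And>b. (LBINT s. W s b * of_real (g s)) = \<phi> b" and \<sigma>: "\<sigma> > 0"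
  shows "(\<lambda>s. gaussian_regularisation (W s) x \<sigma>) \<in> borel_measurable borel"
    and "(LBINT s. gaussian_regularisation (W s) x \<sigma> * of_real (g s)) = gaussian_regularisation \<phi> x \<sigma>"
proof -
  have [measurable]: "g \<in> borel_measurable borel" using g by auto
  have W' [measurable]: "(\<lambda>(s, b). W s b) \<in> borel_measurable (borel \<Otimes>\<^sub>M borel)"
    using W by (simp add: measurable_def space_pair_measure sets_pair_measure)
  have Ws: "W s \<in> borel_measurable borel" for s
    using measurable_compose_Pair1[OF _ W', of s] by simp
  have Lm [measurable]: "(\<lambda>(s, b). laplace_smooth (W s) b) \<in> borel_measurable (borel \<Otimes>\<^sub>M borel)"
    unfolding laplace_smooth_def by measurable
  show "(\<lambda>s. gaussian_regularisation (W s) x \<sigma>) \<in> borel_measurable borel"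
    unfolding gaussian_regularisation_def by measurable
  have L: "(LBINT s. laplace_smooth (W s) b * of_real (g s)) = laplace_smooth \<phi> b" for b
  proof -
    define G where "G s y = of_real (laplace_density (b - y)) * W s y * of_real (g s)" for s y
    have "integrable (lborel \<Otimes>\<^sub>M lborel) (case_prod G)"
    proof (rule integrable_lborel_pair_bound[OF _ integrable_norm[OF g] integrable_laplace_density_translate[of b]])
      show "case_prod G \<in> borel_measurable (lborel \<Otimes>\<^sub>M lborel)" unfolding G_def by measurable
      show "norm (G s y) \<le> norm (g s) * laplace_density (b - y)" for s y
      proof -
        have "laplace_density (b - y) * norm (W s y) * \<bar>g s\<bar> \<le> laplace_density (b - y) * 1 * \<bar>g s\<bar>"
          by (intro mult_mono Wb) auto
        thus ?thesis unfolding G_def norm_mult norm_of_real by (simp add: mult_ac)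
      qed
    qed
    from lborel_pair.Fubini_integral[OF this]
    have "(LBINT s. LBINT y. G s y) = (LBINT y. LBINT s. G s y)" by (rule sym)
    moreover have "(LBINT y. G s y) = laplace_smooth (W s) b * of_real (g s)" for s
      unfolding G_def laplace_smooth_def by (rule integral_mult_left_zero)
    moreover have "(LBINT s. G s y) = of_real (laplace_density (b - y)) * \<phi> y" for y
      unfolding G_def \<phi>[symmetric] mult.assoc by (rule integral_mult_right_zero)
    ultimately show ?thesis by (simp add: laplace_smooth_def)
  qed
  define G where "G s b = iexp (- (b * x)) * of_real (exp (- (\<sigma> * b)\<^sup>2 / 2)) * (laplace_smooth (W s) b * of_real (g s))" for s b
  have k: "integrable lborel (\<lambda>b. exp (- (\<sigma> * b)\<^sup>2 / 2))"
    using integrable_norm[OF has_bochner_integral_gaussian_fourier[OF \<sigma>, of 0, THEN integrable.intros]]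
    by (simp del: of_real_exp)
  have "integrable (lborel \<Otimes>\<^sub>M lborel) (case_prod G)"
  proof (rule integrable_lborel_pair_bound[OF _ integrable_norm[OF g] k])
    show "case_prod G \<in> borel_measurable (lborel \<Otimes>\<^sub>M lborel)" unfolding G_def by measurable
    show "norm (G s b) \<le> norm (g s) * exp (- (\<sigma> * b)\<^sup>2 / 2)" for s b
    proof -
      have "norm (laplace_smooth (W s) b) \<le> 1" by (rule norm_laplace_smooth_le[OF Ws Wb])
      hence "norm (laplace_smooth (W s) b) * \<bar>g s\<bar> \<le> 1 * \<bar>g s\<bar>" by (intro mult_right_mono) auto
      hence "exp (- (\<sigma> * b)\<^sup>2 / 2) * (norm (laplace_smooth (W s) b) * \<bar>g s\<bar>) \<le> exp (- (\<sigma> * b)\<^sup>2 / 2) * (1 * \<bar>g s\<bar>)"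
        by (intro mult_left_mono) auto
      thus ?thesis unfolding G_def norm_mult norm_of_real norm_exp_i_times abs_exp_cancel
        by (simp add: mult.commute)
    qed
  qed
  from lborel_pair.Fubini_integral[OF this]
  have "(LBINT s. LBINT b. G s b) = (LBINT b. LBINT s. G s b)" by (rule sym)
  moreover have "(LBINT b. G s b) = gaussian_regularisation (W s) x \<sigma> * of_real (g s)" for s
    unfolding G_def gaussian_regularisation_def mult.assoc[symmetric] by (rule integral_mult_left_zero)
  moreover have "(LBINT s. G s b) = iexp (- (b * x)) * of_real (exp (- (\<sigma> * b)\<^sup>2 / 2)) * laplace_smooth \<phi> b" for b
    unfolding G_def L[symmetric] by (rule integral_mult_right_zero)
  ultimately show "(LBINT s. gaussian_regularisation (W s) x \<sigma> * of_real (g s)) = gaussian_regularisation \<phi> x \<sigma>"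
    by (simp add: gaussian_regularisation_def)
qed

text \<open>The complex Laplace transform of \<open>g\<close> at the point
  \<open>stable_exponent \<nu> \<theta> b\<close>. The closed range up to \<open>pi / 2\<close>
  includes the purely imaginary exponents of the fundamental solution.\<close>

lemma stable_char_mixture:
  assumes "stable_density \<alpha> r g" "0 \<le> \<theta>" "\<theta> \<le> pi / 2"
  shows "(LBINT s. stable_char \<nu> \<theta> s b * of_real (g s)) = stable_char (\<nu> * \<alpha>) (\<theta> * \<alpha>) r b"
proof -
  have "Re (stable_exponent \<nu> \<theta> b) \<ge> 0"
    unfolding Re_stable_exponent using assms by (intro mult_nonneg_nonneg cos_ge_zero) auto
  from complex_laplace_transform_stable_density[OF assms(1) this]
  show ?thesis
    using stable_exponent_powr[of \<theta> \<nu> b \<alpha>] assms pi_gt_zero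
    by (simp add: stable_char_def mult.commute)
qed

text \<open>Since the power is odd, i b^(2n+1) has modulus
  \<open>\<bar>b\<bar> powr real (2 * n + 1)\<close> and angle \<open>sgn b * (pi / 2)\<close>. The
  first subordination thus fits the common scheme.\<close>

lemma dispersive_symbol_eq_stable_char:
  "dispersive_symbol n s b = stable_char (real (2 * n + 1)) (pi / 2) s b"
proof -
  have "stable_exponent (real (2 * n + 1)) (pi / 2) b = \<i> * of_real (b ^ (2 * n + 1))"
  proof (cases "b = 0")
    case False
    have "\<bar>b\<bar> powr real (2 * n + 1) = \<bar>b\<bar> ^ (2 * n + 1)" using False by (intro powr_realpow) simp
    moreover have "b ^ (2 * n + 1) = sgn b * \<bar>b\<bar> ^ (2 * n + 1)"
      using False by (cases "b > 0") (auto simp: sgn_if power_minus_odd[of "2 * n + 1" b, simplified])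
    moreover have "cis (sgn b * (pi / 2)) = \<i> * of_real (sgn b)"
      using False by (auto simp: sgn_if complex_eq_iff)
    ultimately show ?thesis unfolding stable_exponent_def by (simp only: of_real_mult mult_ac)
  qed simp
  thus ?thesis unfolding dispersive_symbol_def stable_char_def by (simp add: mult_ac)
qed

text \<open>The regularisations of the symbols at time \<open>s\<close>, mixed over
  \<open>s\<close>, are those of \<open>stable_char 1 \<theta> r\<close>, because the order 2n+1
  times 1/(2n+1) is 1. Their limit is computed twice: under the integral over \<open>s\<close> it
  gives the mixture of \<open>u\<close>, and directly it gives the Cauchy density \<open>p\<close>.
  Both carry the same weight \<open>1 / (1 + x\<^sup>2)\<close>.\<close>

lemma subordinated_fundamental_solution:
  fixes u :: "real \<Rightarrow> real \<Rightarrow> real" and g :: "real \<Rightarrow> real"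
  assumes u: "fundamental_solution n u" and n: "n \<ge> 1" and r: "r > 0"
    and g: "stable_density (1 / real (2 * n + 1)) r g"
  defines "\<theta> \<equiv> pi / 2 * (1 / real (2 * n + 1))"
  shows "(LBINT s. u x s * g s) \<ge> 0"
    "of_real (2 * pi * (LBINT s. u x s * g s)) = (LBINT b. iexp (- (b * x)) * stable_char 1 \<theta> r b)"
proof -
  have gi: "integrable lborel g" and g0: "\<And>s. s \<le> 0 \<Longrightarrow> g s = 0" and gnn: "\<And>s. g s \<ge> 0"
    using g by (auto simp: stable_density_def)
  have [measurable]: "g \<in> borel_measurable borel" using gi by auto
  define \<alpha> where "\<alpha> = 1 / real (2 * n + 1)"
  have "\<theta> < pi / 2" "\<theta> > 0" unfolding \<theta>_def using n pi_gt_zero by (simp_all add: field_simps)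
  hence cos: "cos \<theta> > 0" by (intro cos_gt_zero)
  define p where "p x = Re (1 / (of_real r * cis \<theta> + \<i> * of_real x)) / pi" for x
  have p: "p x \<ge> 0" "of_real (2 * pi * p x) = (LBINT b. iexp (- (b * x)) * stable_char 1 \<theta> r b)" for x
    unfolding p_def by (rule cauchy_density_from_stable_char[OF r cos])+
  have \<phi>i: "integrable lborel (stable_char 1 \<theta> r)" by (intro integrable_stable_char r cos) simp
  have \<phi>c: "continuous_on UNIV (stable_char 1 \<theta> r)" by (intro continuous_stable_char) simp
  have \<phi>b: "norm (stable_char 1 \<theta> r b) \<le> 1" for b using r cos by (intro norm_stable_char_le_1) auto
  note inv = fourier_inversion_nonneg[OF \<phi>i \<phi>c \<phi>b p(2) p(1)]
  \<comment> \<open>The Cauchy density is put in the form required of \<open>u\<close>, so that the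
    same limit theorem for regularisations applies to it.\<close>
  have p_FT: "((\<lambda>x. iexp (b * x) * of_real (p x)) has_integral stable_char 1 \<theta> r b) UNIV" for b
    using inv(3)[of b] has_integral_integral_lborel[of "\<lambda>x. iexp (b * x) * of_real (p x)"]
    by (simp add: has_bochner_integral_iff)
  obtain C where C: "\<And>x. \<bar>u x 1\<bar> \<le> C" using fundamental_solutionD(2)[OF u, of 1] by auto
  have uC: "\<bar>u x s\<bar> \<le> s powr (-\<alpha>) * C" if "s > 0" for x s
    using fundamental_solution_scaling[OF u that, of x] C
    by (simp add: abs_mult \<alpha>_def mult_left_mono)
  define \<sigma> :: "nat \<Rightarrow> real" where "\<sigma> k = 1 / (real k + 1)" for k
  have \<sigma>: "\<sigma> k > 0" for k by (simp add: \<sigma>_def)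
  have \<sigma>0: "\<sigma> \<longlonglongrightarrow> 0" unfolding \<sigma>_def by real_asymp
  have Wm: "case_prod (dispersive_symbol n) \<in> borel_measurable (lborel \<Otimes>\<^sub>M lborel)"
    unfolding dispersive_symbol_def[abs_def] by measurable
  have mix: "(LBINT s. dispersive_symbol n s b * of_real (g s)) = stable_char 1 \<theta> r b" for b
    unfolding dispersive_symbol_eq_stable_char \<theta>_def
    by (subst stable_char_mixture[OF g]) (simp_all del: of_nat_add of_nat_mult of_nat_Suc)
  define f where "f k s = gaussian_regularisation (dispersive_symbol n s) x (\<sigma> k) * of_real (g s)" for k s
  have [measurable]: "f k \<in> borel_measurable borel" for k
    unfolding f_def using mixture_gaussian_regularisation(1)[OF Wm norm_dispersive_symbol gi mix \<sigma>] by measurable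
  have f_int: "(LBINT s. f k s) = gaussian_regularisation (stable_char 1 \<theta> r) x (\<sigma> k)" for k
    unfolding f_def by (rule mixture_gaussian_regularisation(2)[OF Wm norm_dispersive_symbol gi mix \<sigma>])
  define F where "F s = complex_of_real (2 * pi) * of_real (u x s / (1 + x\<^sup>2)) * of_real (g s)" for s
  have f_lim: "(\<lambda>k. f k s) \<longlonglongrightarrow> F s" for s
  proof (cases "s > 0")
    case True
    show ?thesis unfolding f_def F_def
      by (intro tendsto_mult[OF _ tendsto_const] gaussian_regularisation_tendsto[OF fundamental_solutionD(1)[OF u True]
          uC[OF True] continuous_dispersive_symbol norm_dispersive_symbol fundamental_solutionD(3)[OF u True] \<sigma> \<sigma>0])
  qed (use g0[of s] in \<open>simp add: f_def F_def\<close>)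
  \<comment> \<open>Measurability of the integrand in \<open>s\<close> is obtained here, as a
    pointwise limit of regularisations that are measurable through their explicit symbols.\<close>
  have Fm: "F \<in> borel_measurable borel" by (rule borel_measurable_LIMSEQ_metric[OF _ f_lim]) measurable
  have "(\<lambda>k. LBINT s. f k s) \<longlonglongrightarrow> (LBINT s. F s)"
  proof (rule integral_dominated_convergence[where w = "\<lambda>s. 2 * pi * C * (s powr (-\<alpha>) * g s)"])
    show "integrable lborel (\<lambda>s. 2 * pi * C * (s powr (-\<alpha>) * g s))"
      unfolding \<alpha>_def by (intro integrable_mult_right integrable_stable_density_negative_moment[OF g r]) simp
    show "AE s in lborel. norm (f k s) \<le> 2 * pi * C * (s powr (-\<alpha>) * g s)" for k
    proof (intro AE_I2)
      fix s
      show "norm (f k s) \<le> 2 * pi * C * (s powr (-\<alpha>) * g s)"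
      proof (cases "s > 0")
        case True
        have "norm (gaussian_regularisation (dispersive_symbol n s) x (\<sigma> k)) \<le> 2 * pi * (s powr (-\<alpha>) * C)"
          by (rule norm_gaussian_regularisation_le[OF fundamental_solutionD(1)[OF u True]
            uC[OF True] continuous_dispersive_symbol norm_dispersive_symbol fundamental_solutionD(3)[OF u True] \<sigma>])
        from mult_right_mono[OF this gnn[of s]] show ?thesis
          using gnn[of s] by (simp add: f_def norm_mult mult_ac)
      qed (use g0[of s] in \<open>simp add: f_def\<close>)
    qed
  qed (use f_lim Fm in auto)
  moreover have "(\<lambda>k. LBINT s. f k s) \<longlonglongrightarrow> of_real (2 * pi) * of_real (p x / (1 + x\<^sup>2))"
    unfolding f_int by (rule gaussian_regularisation_tendsto[OF inv(1) inv(2) \<phi>c \<phi>b p_FT \<sigma> \<sigma>0])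
  ultimately have "(LBINT s. F s) = of_real (2 * pi) * of_real (p x / (1 + x\<^sup>2))" by (rule LIMSEQ_unique)
  also have "(LBINT s. F s) = (LBINT s. complex_of_real (2 * pi / (1 + x\<^sup>2) * (u x s * g s)))"
    unfolding F_def by (intro Bochner_Integration.integral_cong refl) simp
  also have "\<dots> = of_real (2 * pi / (1 + x\<^sup>2) * (LBINT s. u x s * g s))"
    unfolding integral_complex_of_real integral_mult_right_zero ..
  also have "of_real (2 * pi) * complex_of_real (p x / (1 + x\<^sup>2)) = of_real (2 * pi / (1 + x\<^sup>2) * p x)"
    by simp
  finally have "2 * pi / (1 + x\<^sup>2) * (LBINT s. u x s * g s) = 2 * pi / (1 + x\<^sup>2) * p x"
    by (simp only: of_real_eq_iff)
  moreover have "2 * pi / (1 + x\<^sup>2) \<noteq> 0" by (simp add: add_nonneg_eq_0_iff)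
  ultimately have "(LBINT s. u x s * g s) = p x" by (simp only: mult_cancel_left) simp
  thus "(LBINT s. u x s * g s) \<ge> 0"
    "of_real (2 * pi * (LBINT s. u x s * g s)) = (LBINT b. iexp (- (b * x)) * stable_char 1 \<theta> r b)"
    using p[of x] by simp_all
qed

text \<open>For an angle strictly below \<open>pi / 2\<close> the characteristic function decays in
  \<open>b\<close>, so the double integral converges absolutely and inversion commutes with the
  mixture.\<close>

lemma subordinated_stable_density:
  fixes p :: "real \<Rightarrow> real" and g :: "real \<Rightarrow> real"
  assumes p: "\<And>s. s > 0 \<Longrightarrow> of_real (2 * pi * p s) = (LBINT b. iexp (- (b * x)) * stable_char \<nu> \<theta> s b)"
    and g: "stable_density \<alpha> r g" and r: "r > 0" and \<alpha>: "\<alpha> > 0" and \<nu>: "\<nu> > 0" and \<theta>: "0 \<le> \<theta>" "\<theta> < pi / 2"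
  shows "of_real (2 * pi * (LBINT s. p s * g s)) = (LBINT b. iexp (- (b * x)) * stable_char (\<nu> * \<alpha>) (\<theta> * \<alpha>) r b)"
proof -
  have gi: "integrable lborel g" and g0: "\<And>s. s \<le> 0 \<Longrightarrow> g s = 0" and gnn: "\<And>s. g s \<ge> 0"
    and gl: "\<And>l. l \<ge> 0 \<Longrightarrow> (LBINT s. exp (- l * s) * g s) = exp (- r * l powr \<alpha>)"
    using g by (auto simp: stable_density_def)
  have [measurable]: "g \<in> borel_measurable borel" using gi by auto
  have [measurable]: "stable_exponent \<nu> \<theta> \<in> borel_measurable borel"
    by (rule borel_measurable_continuous_onI[OF continuous_stable_exponent[OF \<nu>]])
  define c where "c = cos \<theta>"
  have c: "c > 0" unfolding c_def using \<theta> by (intro cos_gt_zero_pi) auto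
  define G where "G b s = iexp (- (b * x)) * (stable_char \<nu> \<theta> s b * of_real (g s))" for b s
  have Gm: "case_prod G \<in> borel_measurable (lborel \<Otimes>\<^sub>M lborel)"
    unfolding G_def stable_char_def by measurable
  have norm_G: "norm (G b s) = exp (- (c * \<bar>b\<bar> powr \<nu>) * s) * g s" for b s
    unfolding G_def norm_mult norm_exp_i_times norm_of_real norm_stable_char c_def
    using gnn by (simp add: mult_ac)
  have Gi: "integrable lborel (G b)" for b
  proof (rule Bochner_Integration.integrable_bound[OF gi])
    show "G b \<in> borel_measurable lborel" unfolding G_def stable_char_def by measurable
    show "AE s in lborel. norm (G b s) \<le> norm (g s)"
    proof (intro AE_I2)
      fix s show "norm (G b s) \<le> norm (g s)"
        using g0[of s] gnn[of s] c by (cases "s > 0") (auto simp: norm_G intro!: mult_left_le_one_le)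
    qed
  qed
  have "integrable (lborel \<Otimes>\<^sub>M lborel) (case_prod G)"
  proof (rule lborel_pair.Fubini_integrable[OF Gm])
    \<comment> \<open>The modulus decays exponentially in \<open>s\<close> at rate
      \<open>c * \<bar>b\<bar> powr \<nu>\<close>, so its integral is the real Laplace transform of
      \<open>g\<close> at that rate.\<close>
    have "(LBINT s. norm (G b s)) = exp (- (r * c powr \<alpha>) * \<bar>b\<bar> powr (\<nu> * \<alpha>))" for b
      unfolding norm_G using gl[of "c * \<bar>b\<bar> powr \<nu>"] c by (simp add: powr_mult powr_powr mult_ac)
    thus "integrable lborel (\<lambda>b. LBINT s. norm (case (b, s) of (x, xa) \<Rightarrow> G x xa))"
      using integrable_exp_minus_abs_powr[of "r * c powr \<alpha>" "\<nu> * \<alpha>"] r c \<nu> \<alpha> by simp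
    show "AE b in lborel. integrable lborel (\<lambda>s. case (b, s) of (x, xa) \<Rightarrow> G x xa)"
      using Gi by simp
  qed
  from lborel_pair.Fubini_integral[OF this]
  have "(LBINT s. LBINT b. G b s) = (LBINT b. LBINT s. G b s)" .
  moreover have "(LBINT b. G b s) = of_real (2 * pi * (p s * g s))" for s
  proof (cases "s > 0")
    case True
    have "(LBINT b. G b s) = (LBINT b. iexp (- (b * x)) * stable_char \<nu> \<theta> s b) * of_real (g s)"
      unfolding G_def mult.assoc[symmetric] by (rule integral_mult_left_zero)
    thus ?thesis unfolding p[OF True, symmetric] by simp
  qed (use g0[of s] in \<open>simp add: G_def\<close>)
  moreover have "(LBINT s. G b s) = iexp (- (b * x)) * stable_char (\<nu> * \<alpha>) (\<theta> * \<alpha>) r b" for b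
    unfolding G_def integral_mult_right_zero using \<theta> by (subst stable_char_mixture[OF g]) auto
  ultimately show ?thesis
    by (simp only: integral_complex_of_real integral_mult_right_zero)
qed

text \<open>The count starts at \<open>Suc k\<close>: the first subordination brings order 1 and
  angle \<open>pi / (2 * N)\<close>, and each further one divides both by \<open>N\<close>. The
  induction keeps \<open>r\<close> arbitrary because the outer time of one stage is the integration
  variable of the next.\<close>

lemma iterated_density_inversion:
  fixes u h :: "real \<Rightarrow> real \<Rightarrow> real"
  assumes u: "fundamental_solution n u" and n: "n \<ge> 1" and r: "r > 0"
    and h: "stable_subordinator_density (1 / real (2 * n + 1)) h"
  defines "N \<equiv> real (2 * n + 1)"
  shows "iterated_density u h (Suc k) x r \<ge> 0"
    "of_real (2 * pi * iterated_density u h (Suc k) x r) =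
      (LBINT b. iexp (- (b * x)) * stable_char (1 / N ^ k) (pi / (2 * N ^ Suc k)) r b)"
proof -
  have N: "N \<ge> 3" using n by (simp add: N_def)
  have step: "iterated_density u h (Suc k) x r =
      (LBINT s. iterated_density u h k x s * (indicator {0<..} s * h s r))" for k r
    unfolding set_lebesgue_integral_def iterated_density.simps
    by (intro Bochner_Integration.integral_cong) auto
  have g: "stable_density (1 / N) r (\<lambda>s. indicator {0<..} s * h s r)" if "r > 0" for r
    unfolding N_def by (rule stable_density_if_stable_subordinator_density[OF h that])
  have "iterated_density u h (Suc k) x r \<ge> 0 \<and> of_real (2 * pi * iterated_density u h (Suc k) x r) =
      (LBINT b. iexp (- (b * x)) * stable_char (1 / N ^ k) (pi / (2 * N ^ Suc k)) r b)" if "r > 0" for r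
    using that
  proof (induction k arbitrary: r)
    case 0
    from subordinated_fundamental_solution[OF u n 0 g[OF 0, unfolded N_def], of x]
    show ?case unfolding step[of 0] by (simp add: N_def)
  next
    case (Suc k)
    have "iterated_density u h (Suc (Suc k)) x r \<ge> 0"
      unfolding step[of "Suc k"]
    proof (intro integral_nonneg_AE AE_I2)
      fix s
      show "0 \<le> iterated_density u h (Suc k) x s * (indicator {0<..} s * h s r)"
      proof (cases "s > 0")
        case True
        have "indicator {0<..} s * h s r \<ge> 0" using g[OF Suc.prems] unfolding stable_density_def by blast
        with conjunct1[OF Suc.IH[OF True]] show ?thesis by (rule mult_nonneg_nonneg)
      qed simp
    qed
    \<comment> \<open>The strict inequality supplies the decay in \<open>b\<close> on which the
      Fubini exchange for the next subordination rests.\<close>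
    moreover have "pi / (2 * N ^ Suc k) < pi / 2"
    proof -
      have "N ^ 1 \<le> N ^ Suc k" using N by (intro power_increasing) auto
      hence "2 < 2 * N ^ Suc k" using N unfolding power_one_right by linarith
      thus ?thesis by (intro divide_strict_left_mono) auto
    qed
    hence "of_real (2 * pi * (LBINT s. iterated_density u h (Suc k) x s * (indicator {0<..} s * h s r))) =
      (LBINT b. iexp (- (b * x)) * stable_char (1 / N ^ k * (1 / N)) (pi / (2 * N ^ Suc k) * (1 / N)) r b)"
      using N Suc.IH by (intro subordinated_stable_density[OF _ g[OF Suc.prems] Suc.prems])
        (auto simp del: iterated_density.simps)
    hence "of_real (2 * pi * iterated_density u h (Suc (Suc k)) x r) =
      (LBINT b. iexp (- (b * x)) * stable_char (1 / N ^ Suc k) (pi / (2 * N ^ Suc (Suc k))) r b)"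
      unfolding step[of "Suc k"] by (simp add: mult_ac del: iterated_density.simps)
    ultimately show ?case by blast
  qed
  thus "iterated_density u h (Suc k) x r \<ge> 0"
    "of_real (2 * pi * iterated_density u h (Suc k) x r) =
      (LBINT b. iexp (- (b * x)) * stable_char (1 / N ^ k) (pi / (2 * N ^ Suc k)) r b)"
    using r by blast+
qed

text \<open>The exponent is homogeneous of degree \<open>\<nu>\<close> under positive dilations, so
  the product of the characteristic functions at \<open>a * s\<close> and \<open>b * s\<close> is
  the one at \<open>c * s\<close> with \<open>c powr \<nu> = a powr \<nu> + b powr \<nu>\<close>.
  Levy's uniqueness theorem concludes with shift \<open>d = 0\<close>. A law with a density has no
  atoms, hence is non-degenerate.\<close>

lemma stable_law_if_stable_char:
  fixes p :: "real \<Rightarrow> real"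
  assumes [measurable]: "p \<in> borel_measurable borel" and p0: "\<And>x. p x \<ge> 0"
    and FT: "\<And>b. has_bochner_integral lborel (\<lambda>x. iexp (b * x) * of_real (p x)) (stable_char \<nu> \<theta> t b)"
    and \<nu>: "0 < \<nu>" "\<nu> \<le> 2"
  shows "stable_law \<nu> (density lborel (\<lambda>x. ennreal (p x)))"
proof -
  define M where "M = density lborel (\<lambda>x. ennreal (p x))"
  have sets_M [simp, measurable_cong]: "sets M = sets borel" by (simp add: M_def)
  have space_M [simp]: "space M = UNIV" by (simp add: M_def)
  have "has_bochner_integral lborel (\<lambda>x. complex_of_real (p x)) 1"
    using FT[of 0] by (simp add: stable_char_def)
  from has_bochner_integral_bounded_linear[OF bounded_linear_Re this]
  have p1: "has_bochner_integral lborel p 1" by simp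
  have "emeasure M (space M) = (\<integral>\<^sup>+x. ennreal (p x) \<partial>lborel)"
    unfolding M_def by (subst emeasure_density) auto
  also have "\<dots> = 1"
    using p1 p0 by (subst nn_integral_eq_integral) (auto simp: has_bochner_integral_iff)
  finally interpret M: prob_space M by (intro prob_spaceI)
  have M: "real_distribution M" by unfold_locales simp_all
  have M_pair: "pair_prob_space M M" by unfold_locales
  interpret MM: pair_prob_space M M by (rule M_pair)
  have char: "char M b = stable_char \<nu> \<theta> t b" for b
  proof -
    have "char M b = (LBINT x. p x *\<^sub>R iexp (b * x))"
      unfolding char_def M_def by (intro integral_density) (auto simp: p0)
    also have "\<dots> = stable_char \<nu> \<theta> t b"
      using FT[of b] by (simp add: has_bochner_integral_iff scaleR_conv_of_real mult.commute)
    finally show ?thesis .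
  qed
  have "M \<noteq> return borel c" for c
  proof
    assume "M = return borel c"
    hence "emeasure M {c} = 1" by simp
    moreover have "emeasure M {c} = (\<integral>\<^sup>+x. ennreal (p x) * indicator {c} x \<partial>lborel)"
      unfolding M_def by (subst emeasure_density) auto
    moreover have "\<dots> = 0"
      by (subst nn_integral_0_iff_AE) (auto intro!: AE_I[where N = "{c}"] simp: indicator_def)
    ultimately show False by simp
  qed
  moreover have "distr (M \<Otimes>\<^sub>M M) borel (\<lambda>(x, y). a * x + b * y) =
      distr M borel (\<lambda>x. (a powr \<nu> + b powr \<nu>) powr (1 / \<nu>) * x + 0)" if ab: "a > 0" "b > 0" for a b
  proof (rule Levy_uniqueness)
    define c where "c = (a powr \<nu> + b powr \<nu>) powr (1 / \<nu>)"
    have c: "c > 0" "c powr \<nu> = a powr \<nu> + b powr \<nu>"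
    proof -
      have "a powr \<nu> + b powr \<nu> > 0" using ab by (simp add: add_pos_pos)
      thus "c > 0" "c powr \<nu> = a powr \<nu> + b powr \<nu>"
        using \<nu> by (simp_all add: c_def powr_powr)
    qed
    show "real_distribution (distr (M \<Otimes>\<^sub>M M) borel (\<lambda>(x, y). a * x + b * y))"
      by (rule MM.P.real_distribution_distr) measurable
    show "real_distribution (distr M borel (\<lambda>x. (a powr \<nu> + b powr \<nu>) powr (1 / \<nu>) * x + 0))"
      by (rule M.real_distribution_distr) measurable
    show "char (distr (M \<Otimes>\<^sub>M M) borel (\<lambda>(x, y). a * x + b * y)) =
        char (distr M borel (\<lambda>x. (a powr \<nu> + b powr \<nu>) powr (1 / \<nu>) * x + 0))"
    proof
      fix s
      have "char (distr (M \<Otimes>\<^sub>M M) borel (\<lambda>(x, y). a * x + b * y)) s =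
         (LINT z|(M \<Otimes>\<^sub>M M). iexp (s * (case z of (x, y) \<Rightarrow> a * x + b * y)))"
        unfolding char_def by (subst integral_distr) auto
      also have "\<dots> = (LINT x|M. LINT y|M. iexp (s * (a * x + b * y)))"
        by (subst MM.integral_fst'[symmetric])
           (auto intro!: MM.P.integrable_const_bound[where B = 1] simp del: of_real_mult of_real_add)
      also have "\<dots> = (LINT x|M. LINT y|M. iexp ((a * s) * x) * iexp ((b * s) * y))"
        by (simp add: exp_add[symmetric] algebra_simps)
      also have "\<dots> = char M (a * s) * char M (b * s)"
        unfolding char_def integral_mult_right_zero integral_mult_left_zero ..
      also have "\<dots> = char M (c * s)"
        unfolding char stable_char_def stable_exponent_dilate[OF ab(1)] stable_exponent_dilate[OF ab(2)]
          stable_exponent_dilate[OF c(1)] c(2)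
        by (simp add: exp_add[symmetric] algebra_simps)
      also have "\<dots> = char (distr M borel (\<lambda>x. c * x + 0)) s"
        unfolding char_def by (subst integral_distr) (auto simp: mult_ac)
      finally show "char (distr (M \<Otimes>\<^sub>M M) borel (\<lambda>(x, y). a * x + b * y)) s =
        char (distr M borel (\<lambda>x. (a powr \<nu> + b powr \<nu>) powr (1 / \<nu>) * x + 0)) s"
        unfolding c_def .
    qed
  qed
  ultimately show ?thesis
    unfolding M_def[symmetric] stable_law_def using M \<nu> by blast
qed

theorem mainTheorem6:
  fixes n m :: nat and t :: real and u h :: "real \<Rightarrow> real \<Rightarrow> real"
  assumes "n \<ge> 1" and "m \<ge> 1" and "t > 0"
    and "fundamental_solution n u"
    and "stable_subordinator_density (1 / real (2 * n + 1)) h"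
  shows "(\<forall>x. 0 \<le> iterated_density u h m x t)
    \<and> stable_law (1 / real (2 * n + 1) ^ (m - 1))
         (density lborel (\<lambda>x. ennreal (iterated_density u h m x t)))
    \<and> (\<forall>\<beta>::real. \<beta> \<noteq> 0 \<longrightarrow>
         has_bochner_integral lborel
           (\<lambda>x. iexp (\<beta> * x) * complex_of_real (iterated_density u h m x t))
           (exp (- complex_of_real (t * \<bar>\<beta>\<bar> powr (1 / real (2 * n + 1) ^ (m - 1)))
                 * (complex_of_real (cos (pi / (2 * real (2 * n + 1) ^ m)))
                    + \<i> * complex_of_real (\<beta> / \<bar>\<beta>\<bar>)
                        * complex_of_real (sin (pi / (2 * real (2 * n + 1) ^ m)))))))"
proof -
  define N where "N = real (2 * n + 1)"
  define \<nu> where "\<nu> = 1 / N ^ (m - 1)"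
  define \<theta> where "\<theta> = pi / (2 * N ^ m)"
  define p where "p x = iterated_density u h m x t" for x
  \<comment> \<open>The inversion lemma is used with \<open>k = m - 1\<close>: the order carries the
    power \<open>m - 1\<close> and the angle the power \<open>m\<close>.\<close>
  have Suc_m: "Suc (m - 1) = m" using assms(2) by simp
  have N: "N \<ge> 3" using assms(1) by (simp add: N_def)
  have "N ^ 1 \<le> N ^ m" using N assms(2) by (intro power_increasing) auto
  hence "2 < 2 * N ^ m" using N by simp
  hence "\<theta> < pi / 2" unfolding \<theta>_def by (intro divide_strict_left_mono) auto
  moreover have "\<theta> > 0" using N by (simp add: \<theta>_def)
  ultimately have cos: "cos \<theta> > 0" by (intro cos_gt_zero)
  have \<nu>: "\<nu> > 0" "\<nu> \<le> 2"
  proof -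
    have "N ^ (m - 1) \<ge> 1" using N by (intro one_le_power) simp
    thus "\<nu> > 0" "\<nu> \<le> 2" by (simp_all add: \<nu>_def divide_le_eq)
  qed
  have p0: "p x \<ge> 0" and p: "of_real (2 * pi * p x) = (LBINT b. iexp (- (b * x)) * stable_char \<nu> \<theta> t b)" for x
    using iterated_density_inversion[OF assms(4,1,3,5), of "m - 1" x]
    unfolding p_def N_def[symmetric] \<nu>_def \<theta>_def Suc_m by blast+
  have "norm (stable_char \<nu> \<theta> t b) \<le> 1" for b
    using assms(3) cos by (intro norm_stable_char_le_1) auto
  note inv = fourier_inversion_nonneg[OF integrable_stable_char[OF \<nu>(1) assms(3) cos]
      continuous_stable_char[OF \<nu>(1)] this p p0]
  have "stable_law \<nu> (density lborel (\<lambda>x. ennreal (p x)))"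
    by (rule stable_law_if_stable_char[OF borel_measurable_continuous_onI[OF inv(1)] p0 inv(3) \<nu>])
  moreover have "has_bochner_integral lborel (\<lambda>x. iexp (\<beta> * x) * complex_of_real (p x))
      (exp (- complex_of_real (t * \<bar>\<beta>\<bar> powr \<nu>) *
        (complex_of_real (cos \<theta>) + \<i> * complex_of_real (\<beta> / \<bar>\<beta>\<bar>) * complex_of_real (sin \<theta>))))"
    if "\<beta> \<noteq> 0" for \<beta>
  proof -
    \<comment> \<open>For nonzero \<open>\<beta>\<close> the quotient
      \<open>\<beta> / \<bar>\<beta>\<bar>\<close> is \<open>sgn \<beta>\<close>; cosine is even and
      sine odd, so the sign appears only in the imaginary part.\<close>
    have "cis (sgn \<beta> * \<theta>) = complex_of_real (cos \<theta>) + \<i> * complex_of_real (\<beta> / \<bar>\<beta>\<bar>) * complex_of_real (sin \<theta>)"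
      using that by (auto simp: complex_eq_iff sgn_if)
    hence "stable_char \<nu> \<theta> t \<beta> = exp (- complex_of_real (t * \<bar>\<beta>\<bar> powr \<nu>) *
        (complex_of_real (cos \<theta>) + \<i> * complex_of_real (\<beta> / \<bar>\<beta>\<bar>) * complex_of_real (sin \<theta>)))"
      unfolding stable_char_def stable_exponent_def by (simp add: mult.assoc)
    thus ?thesis using inv(3)[of \<beta>] by (simp only:)
  qed
  ultimately show ?thesis
    using p0 unfolding p_def \<nu>_def \<theta>_def N_def by blast
qed

end
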